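(* Let $\phi$ and $\psi$ be minimal almost periodic flows on complete metric spaces $X$ and $Y$, with exponent groups $\mathfrak{M}$ and $\mathfrak{N}$ respectively. Then $\phi$ and $\psi$ are topologically equivalent if and only if $\mathfrak{M}=a\mathfrak{N}$ for some non-zero $a\in\mathbb{R}$.
   Context: A flow on $X$ is a continuous group action $\phi:\mathbb{R}\times X\to X$ of $(\mathbb{R},+)$; the orbit of $x$ is the map $\phi_x:\mathbb{R}\to X$, $t\mapsto\phi(t,x)$. A continuous map $f:\mathbb{R}\to X$ into a metric space $(X,d)$ is almost periodic if for every $\varepsilon>0$ the set of $\tau\in\mathbb{R}$ with $\sup_{t}d(f(t),f(t+\tau))\le\varepsilon$ is relatively dense, i.e. there is $L>0$ such that every interval $(r,r+L)$ meets it. A minimal almost periodic flow is a flow whose orbits are all dense and almost periodic. Let $S^1=\mathbb{R}/\mathbb{Z}$ with quotient map $\pi:\mathbb{R}\to S^1$. The exponent group of an orbit $f$ is $\mathcal{E}_f=\{\alpha\in\mathbb{R}:\{\pi(\alpha t_i)\}\text{ converges in }S^1\text{ for every real sequence }\{t_i\}\text{ such that }\{f(t_i)\}\text{ converges in }X\}$ (for almost periodic $f$ into a complete metric space this coincides with the group denoted $\mathfrak{M}_f$); in a minimal flow this group is the same for all orbits, and is called the exponent group of the flow. $a\mathfrak{N}=\{a\nu:\nu\in\mathfrak{N}\}$. Flows $\phi$ on $X$ and $\psi$ on $Y$ are topologically equivalent if there is a homeomorphism $h:X\to Y$ mapping orbits of $\phi$ onto orbits of $\psi$ in such a way that the orientation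 of orbits is preserved. *)

theory Defs
  imports "HOL-Analysis.Analysis"
begin

quotient_type circle = real / "\<lambda>x y. x - y \<in> \<int>"
  morphisms rep_circle circle_proj
proof (rule equivpI)
  show "reflp (\<lambda>x y::real. x - y \<in> \<int>)"
    by (simp add: reflp_def)
  show "symp (\<lambda>x y::real. x - y \<in> \<int>)"
    by (metis (lifting) Ints_minus minus_diff_eq sympI)
  show "transp (\<lambda>x y::real. x - y \<in> \<int>)"
  proof (rule transpI)
    fix x y z :: real
    assume "x - y \<in> \<int>" "y - z \<in> \<int>"
    then have "(x - y) + (y - z) \<in> \<int>" by (rule Ints_add)
    then show "x - z \<in> \<int>" by simp
  qed
qed

text \<open>The circle carries the quotient topology of \<^term>\<open>circle_proj\<close>.\<close>

instantiation circle :: topological_space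
begin

definition open_circle :: "circle set \<Rightarrow> bool" where
  "open_circle U \<longleftrightarrow> open (circle_proj -` U)"

instance
proof
  show "open (UNIV :: circle set)"
    by (simp add: open_circle_def)
next
  fix S T :: "circle set"
  assume "open S" "open T"
  then show "open (S \<inter> T)"
    by (simp add: open_circle_def vimage_Int open_Int)
next
  fix K :: "circle set set"
  assume "\<forall>S\<in>K. open S"
  then show "open (\<Union>K)"
    by (auto simp: open_circle_def vimage_Union intro: open_UN)
qed

end

definition flow :: "(real \<Rightarrow> 'a::topological_space \<Rightarrow> 'a) \<Rightarrow> bool" where
  "flow \<phi> \<longleftrightarrow>
     continuous_on UNIV (\<lambda>(t, x). \<phi> t x) \<and>
     (\<forall>x. \<phi> 0 x = x) \<and>
     (\<forall>s t x. \<phi> (s + t) x = \<phi> s (\<phi> t x))"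

definition orbit_map :: "(real \<Rightarrow> 'a \<Rightarrow> 'a) \<Rightarrow> 'a \<Rightarrow> real \<Rightarrow> 'a" where
  "orbit_map \<phi> x = (\<lambda>t. \<phi> t x)"

definition relatively_dense :: "real set \<Rightarrow> bool" where
  "relatively_dense S \<longleftrightarrow> (\<exists>L>0. \<forall>r. S \<inter> {r<..<r + L} \<noteq> {})"

text \<open>The supremum is taken in the extended reals, so that it is \<open>\<infinity>\<close>
  (rather than unspecified) when the distances are unbounded.\<close>

definition almost_periodic :: "(real \<Rightarrow> 'a::metric_space) \<Rightarrow> bool" where
  "almost_periodic f \<longleftrightarrow>
     continuous_on UNIV f \<and>
     (\<forall>\<epsilon>>0. relatively_dense {\<tau>. (SUP t. ereal (dist (f t) (f (t + \<tau>)))) \<le> ereal \<epsilon>})"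

definition minimal_almost_periodic_flow :: "(real \<Rightarrow> 'a::metric_space \<Rightarrow> 'a) \<Rightarrow> bool" where
  "minimal_almost_periodic_flow \<phi> \<longleftrightarrow>
     flow \<phi> \<and>
     (\<forall>x. closure (range (orbit_map \<phi> x)) = UNIV \<and> almost_periodic (orbit_map \<phi> x))"

definition exponent_group :: "(real \<Rightarrow> 'a::topological_space) \<Rightarrow> real set" where
  "exponent_group f =
     {\<alpha>. \<forall>t :: nat \<Rightarrow> real.
           convergent (\<lambda>i. f (t i)) \<longrightarrow> convergent (\<lambda>i. circle_proj (\<alpha> * t i))}"

text \<open>The common exponent group of all orbits; it is meaningful only for flows, such as
  minimal almost periodic ones on complete spaces, whose orbits share one exponent group.\<close>

definition flow_exponent_group :: "(real \<Rightarrow> 'a::topological_space \<Rightarrow> 'a) \<Rightarrow> real set" where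
  "flow_exponent_group \<phi> = (THE M. \<forall>x. exponent_group (orbit_map \<phi> x) = M)"

text \<open>Preservation of orientation: along each orbit, \<open>h\<close> is a continuous, strictly increasing
  change of time. For periodic orbits \<open>\<sigma>\<close> is a lift of the induced map of circles, and on fixed
  points the condition is vacuous. Surjectivity of \<open>\<sigma>\<close> is not required separately: on
  non-constant orbits it follows from \<open>h\<close> being a bijection of orbits.\<close>

definition topologically_equivalent ::
  "(real \<Rightarrow> 'a::topological_space \<Rightarrow> 'a) \<Rightarrow> (real \<Rightarrow> 'b::topological_space \<Rightarrow> 'b) \<Rightarrow> bool" where
  "topologically_equivalent \<phi> \<psi> \<longleftrightarrow>
     (\<exists>h k. homeomorphism UNIV UNIV h k \<and>
        (\<forall>x. h ` range (orbit_map \<phi> x) = range (orbit_map \<psi> (h x))) \<and>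
        (\<forall>x. \<exists>\<sigma> :: real \<Rightarrow> real. continuous_on UNIV \<sigma> \<and> strict_mono \<sigma> \<and>
               (\<forall>t. h (orbit_map \<phi> x t) = orbit_map \<psi> (h x) (\<sigma> t))))"

end

theory Submission
  imports Defs
begin

text \<open>
  Let \<open>D \<tau>\<close> be the supremum over all \<open>x\<close> of the distance from \<open>x\<close> to \<open>\<phi> \<tau> x\<close>. Almost periodicity
  makes the space compact and the flow equicontinuous, so \<open>\<phi> s x\<close> and \<open>\<phi> t x\<close> are close exactly when
  \<open>D (t - s)\<close> is small. Hence the exponent group of every orbit consists of those \<open>\<alpha>\<close> for which
  \<open>\<tau> \<mapsto> exp (2\<pi>i\<alpha>\<tau>)\<close> is continuous at 0 with respect to \<open>D\<close>.

  If the groups agree up to a factor, which may be taken positive because they are closed under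
  negation, a conjugacy exists as soon as the exponents control \<open>D\<close>: some Bohr set given by finitely
  many exponents lies in \<open>{\<tau>. D \<tau> \<le> \<epsilon>}\<close>. This replaces the approximation theorem for almost periodic
  functions and comes from Bogolyubov's finite Fourier argument, applied to \<open>max 0 (1 - D / \<epsilon>')\<close>
  sampled on finer and longer grids.

  Conversely, an equivalence with time change \<open>\<sigma>\<close> turns an exponent \<open>\<nu>\<close> of \<open>\<psi>\<close> into an almost periodic
  phase \<open>\<nu> \<sigma>(t)\<close>, which by Bohr's theorem is \<open>\<mu> t + O(1)\<close> with \<open>\<mu>\<close> an exponent of \<open>\<phi>\<close>. So
  \<open>\<sigma>(t) = a t + O(1)\<close> with \<open>\<mu> = a \<nu>\<close>, and the same applied to the inverse of \<open>\<sigma>\<close> gives equality.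
\<close>

section \<open>Characters of the real line and the circle\<close>


definition ei :: "real \<Rightarrow> complex" where
  "ei x = cis (2 * pi * x)"

lemma ei_0 [simp]: "ei 0 = 1"
  by (simp add: ei_def)

lemma norm_ei [simp]: "norm (ei x) = 1"
  by (simp add: ei_def)

lemma ei_add: "ei (x + y) = ei x * ei y"
  by (simp add: ei_def cis_mult distrib_left)

lemma ei_minus: "ei (- x) = cnj (ei x)"
  by (simp add: ei_def cis_cnj)

lemma ei_diff: "ei (x - y) = ei x * cnj (ei y)"
  using ei_add[of x "- y"] by (simp add: ei_minus)

lemma ei_power: "ei x ^ n = ei (real n * x)"
  by (induction n) (auto simp: ei_add algebra_simps)

lemma ei_eq_1_iff: "ei x = 1 \<longleftrightarrow> x \<in> \<int>"
proof
  assume "ei x = 1"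
  then have "cos (2 * pi * x) = 1"
    by (auto simp: ei_def complex_eq_iff)
  then obtain k :: int where "2 * pi * x = of_int k * 2 * pi"
    using cos_one_2pi_int by blast
  then have "x = of_int k" by simp
  then show "x \<in> \<int>" by simp
next
  assume "x \<in> \<int>"
  then obtain k :: int where "x = of_int k" by (auto elim: Ints_cases)
  then show "ei x = 1"
    using cis_multiple_2pi[of "of_int k"] by (simp add: ei_def mult.commute)
qed

lemma Re_ei_minus: "Re (ei (- x)) = Re (ei x)"
  by (simp add: ei_minus)

lemma norm_ei_diff: "norm (ei x - ei y) = norm (ei (x - y) - 1)"
proof -
  have "ei x - ei y = (ei (x - y) - 1) * ei y"
    using ei_add[of "x - y" y] by (simp add: algebra_simps)
  then show ?thesis by (simp add: norm_mult)
qed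

lemma norm_ei_minus: "norm (ei (- x) - 1) = norm (ei x - 1)"
  using norm_ei_diff[of 0 x] by (simp add: norm_minus_commute)

lemma continuous_on_ei [continuous_intros]:
  "continuous_on S f \<Longrightarrow> continuous_on S (\<lambda>x. ei (f x))"
  unfolding ei_def by (intro continuous_intros)

lemma tendsto_ei [tendsto_intros]: "(f \<longlongrightarrow> l) F \<Longrightarrow> ((\<lambda>x. ei (f x)) \<longlongrightarrow> ei l) F"
  unfolding ei_def by (intro tendsto_intros)

lemma Re_ei_ge: "Re (ei x) \<ge> 1 - norm (ei x - 1)"
  using abs_Re_le_cmod[of "ei x - 1"] by simp

text \<open>For these \<open>x\<close> the point \<open>ei x\<close> lies in the closed left half
  plane, which has distance 1 from the point 1. This detects a phase turned by at least a
  quarter.\<close>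

lemma norm_ei_ge_1:
  assumes "1/4 \<le> \<bar>x\<bar>" "\<bar>x\<bar> \<le> 3/4"
  shows "1 \<le> norm (ei x - 1)"
proof -
  have "cos (2 * pi * \<bar>x\<bar>) = - sin (2 * pi * \<bar>x\<bar> - pi / 2)"
    by (simp add: sin_diff)
  moreover have "2 * pi * (1/4) \<le> 2 * pi * \<bar>x\<bar>" "2 * pi * \<bar>x\<bar> \<le> 2 * pi * (3/4)"
    using assms by (intro mult_left_mono; simp)+
  then have "0 \<le> 2 * pi * \<bar>x\<bar> - pi / 2" "2 * pi * \<bar>x\<bar> - pi / 2 \<le> pi"
    by linarith+
  then have "0 \<le> sin (2 * pi * \<bar>x\<bar> - pi / 2)"
    by (rule sin_ge_zero)
  moreover have "Re (ei x) = cos (2 * pi * \<bar>x\<bar>)"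
    by (cases "x \<ge> 0") (auto simp: ei_def)
  ultimately have "Re (ei x) \<le> 0" by linarith
  then show ?thesis
    using Re_ei_ge[of x] by linarith
qed

text \<open>By compactness \<open>norm (ei x - 1)\<close> has a positive minimum over the x with
  \<epsilon> \<le> |x| \<le> 1/2. Subtracting the nearest integer brings every x into [-1/2, 1/2]
  without changing \<open>ei x\<close>.\<close>

lemma ei_near_1_imp_near_int:
  assumes "\<epsilon> > 0"
  obtains \<delta> where "\<delta> > 0" "\<And>x. norm (ei x - 1) < \<delta> \<Longrightarrow> \<bar>x - of_int (round x)\<bar> < \<epsilon>"
proof (cases "\<epsilon> > 1/2")
  case True
  show ?thesis
  proof (rule that[of 1])
    fix x :: real
    show "\<bar>x - of_int (round x)\<bar> < \<epsilon>"
      using of_int_round_abs_le[of x] True by (simp add: abs_minus_commute)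
  qed simp
next
  case False
  let ?K = "{-1/2..-\<epsilon>} \<union> {\<epsilon>..1/2::real}"
  have "compact ?K" by (intro compact_Un compact_Icc)
  moreover have "?K \<noteq> {}" using False by auto
  moreover have "continuous_on ?K (\<lambda>x. norm (ei x - 1))"
    by (intro continuous_intros)
  ultimately obtain y where y: "y \<in> ?K" "\<And>x. x \<in> ?K \<Longrightarrow> norm (ei y - 1) \<le> norm (ei x - 1)"
    using continuous_attains_inf by metis
  have "y \<notin> \<int>"
  proof
    assume "y \<in> \<int>"
    then obtain k :: int where "y = of_int k" by (auto elim: Ints_cases)
    then have "\<bar>real_of_int k\<bar> \<le> 1/2" "k \<noteq> 0" using y(1) assms by auto
    then show False by linarith
  qed
  then have pos: "norm (ei y - 1) > 0" using ei_eq_1_iff by auto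
  show ?thesis
  proof (rule that[OF pos])
    fix x :: real
    assume x: "norm (ei x - 1) < norm (ei y - 1)"
    let ?z = "x - of_int (round x)"
    have "ei (of_int (round x)) = 1" by (simp add: ei_eq_1_iff)
    then have "ei ?z = ei x"
      by (simp add: ei_diff)
    then have "?z \<notin> ?K" using y(2)[of ?z] x by auto
    moreover have "\<bar>?z\<bar> \<le> 1/2"
      using of_int_round_abs_le[of x] by (simp add: abs_minus_commute)
    ultimately show "\<bar>?z\<bar> < \<epsilon>" by auto
  qed
qed

lemma ei_near_1:
  assumes "\<epsilon> > 0"
  obtains \<delta> where "\<delta> > 0" "\<And>x. \<bar>x\<bar> < \<delta> \<Longrightarrow> norm (ei x - 1) < \<epsilon>"
proof -
  have "(ei \<longlongrightarrow> ei 0) (at 0)"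
    by (intro tendsto_ei tendsto_ident_at)
  from LIM_D[OF this assms] obtain \<delta> where "\<delta> > 0"
    and d: "\<And>x. x \<noteq> 0 \<Longrightarrow> \<bar>x\<bar> < \<delta> \<Longrightarrow> norm (ei x - 1) < \<epsilon>"
    by auto
  show ?thesis
  proof (rule that[OF \<open>\<delta> > 0\<close>])
    show "norm (ei x - 1) < \<epsilon>" if "\<bar>x\<bar> < \<delta>" for x
      using d[of x] that assms by (cases "x = 0") auto
  qed
qed

section \<open>The quotient circle and the unit circle in the complex plane\<close>

lift_definition circle_ei :: "circle \<Rightarrow> complex" is ei
proof -
  fix x y :: real
  assume "x - y \<in> \<int>"
  then have "norm (ei x - ei y) = 0"
    by (simp add: norm_ei_diff ei_eq_1_iff)
  then show "ei x = ei y" by simp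
qed

lemma circle_proj_eq_iff: "circle_proj x = circle_proj y \<longleftrightarrow> x - y \<in> \<int>"
  by (rule circle.abs_eq_iff)

lemma continuous_on_circle_ei: "continuous_on UNIV circle_ei"
proof (rule continuous_on_open_invariant[THEN iffD2], intro allI impI)
  fix B :: "complex set"
  assume "open B"
  have "circle_proj -` (circle_ei -` B) = ei -` B"
    by (auto simp: circle_ei.abs_eq)
  moreover have "open (ei -` B)"
    using \<open>open B\<close> continuous_on_ei[OF continuous_on_id] by (rule open_vimage)
  ultimately show "\<exists>A. open A \<and> A \<inter> UNIV = circle_ei -` B \<inter> UNIV"
    by (auto simp: open_circle_def)
qed

text \<open>Convergence moves from the quotient topology to the complex plane, where Cauchy
  sequences are available. For the converse, the limit has norm 1, hence is some
  \<open>ei y\<close>, and a phase close to \<open>ei y\<close> puts \<open>x i\<close> near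
  \<open>y\<close> after subtracting an integer, which does not change the class.\<close>

lemma convergent_circle_proj_iff:
  "convergent (\<lambda>i. circle_proj (x i)) \<longleftrightarrow> convergent (\<lambda>i::nat. ei (x i))"
proof
  assume "convergent (\<lambda>i. circle_proj (x i))"
  then obtain c where "(\<lambda>i. circle_proj (x i)) \<longlonglongrightarrow> c"
    by (auto simp: convergent_def)
  then have "(\<lambda>i. circle_ei (circle_proj (x i))) \<longlonglongrightarrow> circle_ei c"
    using continuous_on_tendsto_compose[OF continuous_on_circle_ei] by auto
  then show "convergent (\<lambda>i. ei (x i))"
    by (auto simp: circle_ei.abs_eq convergent_def)
next
  assume "convergent (\<lambda>i. ei (x i))"
  then obtain z where z: "(\<lambda>i. ei (x i)) \<longlonglongrightarrow> z"
    by (auto simp: convergent_def)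
  then have "(\<lambda>i. norm (ei (x i))) \<longlonglongrightarrow> norm z"
    by (intro tendsto_intros)
  then have "norm z = 1" by (simp add: LIMSEQ_const_iff)
  then have "z \<noteq> 0" by auto
  define y where "y = Arg z / (2 * pi)"
  have y: "ei y = z"
    using \<open>norm z = 1\<close> cis_Arg[OF \<open>z \<noteq> 0\<close>] by (simp add: y_def ei_def sgn_div_norm)
  have "(\<lambda>i. circle_proj (x i)) \<longlonglongrightarrow> circle_proj y"
  proof (rule topological_tendstoI)
    fix U :: "circle set"
    assume U: "open U" "circle_proj y \<in> U"
    then have "open (circle_proj -` U)" by (simp add: open_circle_def)
    with U obtain \<epsilon> where e: "\<epsilon> > 0" "\<And>w. dist w y < \<epsilon> \<Longrightarrow> circle_proj w \<in> U"
      by (auto simp: open_dist)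
    obtain \<delta> where d: "\<delta> > 0" "\<And>x. norm (ei x - 1) < \<delta> \<Longrightarrow> \<bar>x - of_int (round x)\<bar> < \<epsilon>"
      using ei_near_1_imp_near_int[OF e(1)] by metis
    have "eventually (\<lambda>i. dist (ei (x i)) z < \<delta>) sequentially"
      using z d(1) by (rule tendstoD)
    then show "eventually (\<lambda>i. circle_proj (x i) \<in> U) sequentially"
    proof eventually_elim
      case (elim i)
      let ?k = "of_int (round (x i - y)) :: real"
      have "norm (ei (x i - y) - 1) < \<delta>"
        using elim by (simp add: dist_norm y[symmetric] norm_ei_diff)
      then have "\<bar>x i - y - ?k\<bar> < \<epsilon>" by (rule d(2))
      then have "circle_proj (x i - ?k) \<in> U"
        by (intro e(2)) (simp add: dist_real_def algebra_simps)
      moreover have "circle_proj (x i) = circle_proj (x i - ?k)"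
        by (simp add: circle_proj_eq_iff)
      ultimately show ?case by simp
    qed
  qed
  then show "convergent (\<lambda>i. circle_proj (x i))"
    by (auto simp: convergent_def)
qed

section \<open>Bohr sets via finite Fourier analysis\<close>

text \<open>Orthogonality of the characters of the cyclic group of order \<open>4 * n\<close>: for
  nonzero \<open>m\<close> the sum is geometric, with a nontrivial root of unity as ratio. Centring
  the grid on [-1/2, 1/2) only contributes a constant phase.\<close>

lemma sum_ei_grid:
  fixes m :: int and n :: nat
  assumes "\<bar>m\<bar> < 4 * int n"
  shows "(\<Sum>k<4*n. ei (of_int m * ((real k - 2 * real n) / (4 * real n))))
    = (if m = 0 then of_nat (4 * n) else 0)"
proof (cases "m = 0")
  case True
  then show ?thesis by simp
next
  case False
  have n: "n > 0" using assms by (cases n) auto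
  define z where "z = ei (of_int m / (4 * real n))"
  have "of_int m / (4 * real n) \<notin> \<int>"
  proof
    assume "of_int m / (4 * real n) \<in> \<int>"
    then obtain j :: int where "of_int m / (4 * real n) = of_int j"
      by (auto elim: Ints_cases)
    then have "real_of_int m = of_int (j * (4 * int n))"
      using n by (simp add: field_simps)
    then have "m = j * (4 * int n)" by (simp only: of_int_eq_iff)
    moreover from this False have "\<bar>j\<bar> \<ge> 1" by auto
    ultimately have "\<bar>m\<bar> \<ge> 4 * int n"
      using mult_right_mono[of 1 "\<bar>j\<bar>" "4 * int n"] by (simp add: abs_mult)
    then show False using assms by simp
  qed
  then have "z \<noteq> 1" by (simp add: z_def ei_eq_1_iff)
  have "z ^ (4 * n) = 1"
    using n by (simp add: z_def ei_power ei_eq_1_iff)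
  have "ei (of_int m * ((real k - 2 * real n) / (4 * real n))) = ei (- of_int m / 2) * z ^ k" for k
    using n by (simp add: z_def ei_power ei_add[symmetric] field_simps)
  then have "(\<Sum>k<4*n. ei (of_int m * ((real k - 2 * real n) / (4 * real n))))
      = ei (- of_int m / 2) * (\<Sum>k<4*n. z ^ k)"
    by (simp add: sum_distrib_left)
  also have "(\<Sum>k<4*n. z ^ k) = 0"
    using \<open>z \<noteq> 1\<close> \<open>z ^ (4 * n) = 1\<close> by (simp add: geometric_sum)
  finally show ?thesis using False by simp
qed


text \<open>Bogolyubov's argument in \<open>\<int>/4n\<close>: the sum of \<open>\<bar>U\<bar>\<^sup>4\<close> against a character counts weighted
  representations \<open>j = a - b + a' - b'\<close>. Since \<open>u\<close> lives on \<open>{0..<n}\<close> and \<open>j < 2n\<close>,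
  nothing wraps around modulo \<open>4n\<close>.\<close>

lemma finite_bogolyubov:
  fixes u :: "nat \<Rightarrow> real" and n :: nat and c :: real
  defines "\<theta> \<equiv> \<lambda>k::nat. (real k - 2 * real n) / (4 * real n)"
    and "U \<equiv> \<lambda>x::real. \<Sum>a<n. of_real (u a) * ei (- (real a * x))"
  defines "K \<equiv> {x \<in> \<theta> ` {..<4*n}. norm (U x) \<ge> c\<^sup>2 / 4 * n}"
  assumes n: "n > 0" and c: "0 < c" "c \<le> 1"
    and u: "\<And>a. 0 \<le> u a" "\<And>a. u a \<le> 1" and mean: "(\<Sum>a<n. u a) \<ge> c * n"
  shows "finite K" and "0 \<in> K" and "card K \<le> 64 / c ^ 4"
    and "\<And>x. x \<in> K \<Longrightarrow> \<bar>x\<bar> \<le> 1/2"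
    and "\<And>j::nat. j < 2 * n \<Longrightarrow> (\<And>x. x \<in> K \<Longrightarrow> Re (ei (real j * x)) \<ge> 0) \<Longrightarrow>
      \<exists>a b a' b'. u a > 0 \<and> u b > 0 \<and> u a' > 0 \<and> u b' > 0 \<and> int j = int a - int b + int a' - int b'"
proof -
  \<comment> \<open>With Parseval this threshold limits the contribution of the frequencies outside
    \<open>K\<close> to (c n)^4 / 4 in absolute value, less than the (c n)^4 guaranteed by frequency
    0.\<close>
  define \<eta> where "\<eta> = c\<^sup>2 / 4"
  have \<eta>: "\<eta> > 0" "\<eta> \<le> c"
    using c power_le_one[of c 1] by (auto simp: \<eta>_def power2_eq_square mult_le_cancel_left1 intro: order_trans[of _ c])
  define S where "S = {..<n} \<times> {..<n}"
  define w where "w = (\<lambda>p. u (fst p) * u (snd p))"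
  define d where "d = (\<lambda>p::nat \<times> nat. int (fst p) - int (snd p))"
  have finS: "finite S" by (simp add: S_def)
  have d_abs: "\<bar>d p\<bar> < int n" if "p \<in> S" for p
    using that by (auto simp: d_def S_def)
  have inj: "inj_on \<theta> {..<4*n}"
    using n by (auto simp: inj_on_def \<theta>_def field_simps)
  show "finite K" by (simp add: K_def)
  have sq: "complex_of_real ((norm (U x))\<^sup>2) = (\<Sum>p\<in>S. of_real (w p) * ei (- (of_int (d p) * x)))" for x
  proof -
    have "complex_of_real ((norm (U x))\<^sup>2) = U x * cnj (U x)"
      by (rule complex_norm_square)
    also have "\<dots> = (\<Sum>a<n. \<Sum>b<n. (of_real (u a) * ei (- (real a * x))) * (of_real (u b) * ei (real b * x)))"
      by (simp add: U_def sum_product ei_minus)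
    also have "\<dots> = (\<Sum>a<n. \<Sum>b<n. of_real (u a * u b) * ei (- (of_int (int a - int b) * x)))"
    proof (intro sum.cong refl)
      fix a b
      have "ei (- (of_int (int a - int b) * x)) = ei (- (real a * x)) * ei (real b * x)"
        by (simp add: algebra_simps flip: ei_add)
      then show "(of_real (u a) * ei (- (real a * x))) * (of_real (u b) * ei (real b * x))
          = of_real (u a * u b) * ei (- (of_int (int a - int b) * x))"
        by simp
    qed
    also have "\<dots> = (\<Sum>p\<in>S. of_real (w p) * ei (- (of_int (d p) * x)))"
      by (simp add: S_def w_def d_def sum.cartesian_product case_prod_unfold)
    finally show ?thesis .
  qed
  have grid: "(\<Sum>x\<in>\<theta> ` {..<4*n}. ei (of_int m * x)) = (if m = 0 then of_nat (4 * n) else 0)"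
    if "\<bar>m\<bar> < 4 * int n" for m
    unfolding sum.reindex[OF inj] comp_def using sum_ei_grid[OF that] by (simp only: \<theta>_def)
  \<comment> \<open>Only pairs with equal entries survive the sum over the grid, since the
    differences stay below \<open>n\<close> in absolute value.\<close>
  have parseval: "(\<Sum>x\<in>\<theta> ` {..<4*n}. (norm (U x))\<^sup>2) \<le> 4 * (real n)\<^sup>2"
  proof -
    have "complex_of_real (\<Sum>x\<in>\<theta> ` {..<4*n}. (norm (U x))\<^sup>2)
        = (\<Sum>x\<in>\<theta> ` {..<4*n}. \<Sum>p\<in>S. of_real (w p) * ei (- (of_int (d p) * x)))"
      by (simp only: of_real_sum sq)
    also have "\<dots> = (\<Sum>p\<in>S. of_real (w p) * (\<Sum>x\<in>\<theta> ` {..<4*n}. ei (of_int (- d p) * x)))"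
      by (subst sum.swap) (simp add: sum_distrib_left)
    also have "\<dots> = (\<Sum>p\<in>S. of_real (w p) * (if d p = 0 then of_nat (4 * n) else 0))"
    proof (intro sum.cong refl)
      fix p assume "p \<in> S"
      then have "\<bar>- d p\<bar> < 4 * int n" using d_abs[of p] by simp
      from grid[OF this] show "of_real (w p) * (\<Sum>x\<in>\<theta> ` {..<4*n}. ei (of_int (- d p) * x))
          = of_real (w p) * (if d p = 0 then of_nat (4 * n) else 0)" by simp
    qed
    also have "\<dots> = (\<Sum>a<n. \<Sum>b<n. of_real (u a * u b) * (if a = b then of_nat (4 * n) else 0))"
      by (simp add: S_def w_def d_def sum.cartesian_product case_prod_unfold)
    also have "\<dots> = of_real (4 * real n * (\<Sum>a<n. (u a)\<^sup>2))"
      by (simp add: if_distrib[of "(*) _"] sum.delta' sum_distrib_left power2_eq_square mult.commute cong: if_cong)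
    finally have "(\<Sum>x\<in>\<theta> ` {..<4*n}. (norm (U x))\<^sup>2) = 4 * real n * (\<Sum>a<n. (u a)\<^sup>2)"
      by (simp only: of_real_eq_iff)
    also have "(\<Sum>a<n. (u a)\<^sup>2) \<le> (\<Sum>a<n. 1)"
      using u by (intro sum_mono power_le_one) auto
    finally show ?thesis using n by (simp add: power2_eq_square)
  qed
  have U0: "norm (U 0) \<ge> c * n"
  proof -
    have "U 0 = of_real (\<Sum>a<n. u a)" by (simp add: U_def)
    then have "norm (U 0) = \<bar>\<Sum>a<n. u a\<bar>" by (simp only: norm_of_real)
    then show ?thesis using mean by linarith
  qed
  have "\<theta> (2 * n) = 0" by (simp add: \<theta>_def)
  then have zero: "0 \<in> \<theta> ` {..<4*n}" using n by (intro image_eqI[of _ _ "2*n"]) auto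
  show "0 \<in> K"
  proof -
    have "\<eta> * n \<le> c * n" using \<eta> by (intro mult_right_mono) auto
    then show ?thesis using U0 zero by (simp add: K_def \<eta>_def)
  qed
  show "card K \<le> 64 / c ^ 4"
  proof -
    have "real (card K) * (\<eta> * n)\<^sup>2 = (\<Sum>x\<in>K. (\<eta> * n)\<^sup>2)" by simp
    also have "\<dots> \<le> (\<Sum>x\<in>K. (norm (U x))\<^sup>2)"
      using \<eta> by (intro sum_mono power_mono) (auto simp: K_def \<eta>_def)
    also have "\<dots> \<le> (\<Sum>x\<in>\<theta> ` {..<4*n}. (norm (U x))\<^sup>2)"
      by (intro sum_mono2) (auto simp: K_def)
    also note parseval
    finally have "real (card K) * \<eta>\<^sup>2 \<le> 4"
      using n by (simp add: power_mult_distrib)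
    then show ?thesis
      using c by (simp add: \<eta>_def field_simps power2_eq_square power4_eq_xxxx)
  qed
  show "\<bar>x\<bar> \<le> 1/2" if "x \<in> K" for x
    using that n by (auto simp: K_def \<theta>_def abs_le_iff field_simps)
  fix j :: nat
  assume j: "j < 2 * n" and pos: "\<And>x. x \<in> K \<Longrightarrow> Re (ei (real j * x)) \<ge> 0"
  show "\<exists>a b a' b'. u a > 0 \<and> u b > 0 \<and> u a' > 0 \<and> u b' > 0 \<and> int j = int a - int b + int a' - int b'"
  proof (rule ccontr)
    assume none: "\<not> ?thesis"
    define N where "N = (\<lambda>x. (norm (U x))\<^sup>2)"
    \<comment> \<open>Either the frequency is nonzero and small enough for orthogonality, or the
      lack of a representation of \<open>j\<close> makes one of the four weights zero.\<close>
    have vanish: "of_real (w p) * of_real (w q) * (\<Sum>x\<in>\<theta> ` {..<4*n}. ei (of_int (int j - d p - d q) * x)) = 0"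
      if "p \<in> S" "q \<in> S" for p q
    proof (cases "int j = d p + d q")
      case True
      have "int j = int (fst p) - int (snd p) + int (fst q) - int (snd q)"
        using True by (simp add: d_def)
      with none have "\<not> (u (fst p) > 0 \<and> u (snd p) > 0 \<and> u (fst q) > 0 \<and> u (snd q) > 0)"
        by blast
      then have "u (fst p) = 0 \<or> u (snd p) = 0 \<or> u (fst q) = 0 \<or> u (snd q) = 0"
        using u(1)[of "fst p"] u(1)[of "snd p"] u(1)[of "fst q"] u(1)[of "snd q"] by linarith
      then show ?thesis by (auto simp: w_def)
    next
      case False
      have "\<bar>int j - d p - d q\<bar> < 4 * int n"
        using d_abs[OF that(1)] d_abs[OF that(2)] j by linarith
      then show ?thesis unfolding grid[OF \<open>\<bar>int j - d p - d q\<bar> < 4 * int n\<close>] using False by simp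
    qed
    have "(\<Sum>x\<in>\<theta> ` {..<4*n}. complex_of_real (N x) * of_real (N x) * ei (real j * x))
      = (\<Sum>x\<in>\<theta> ` {..<4*n}. \<Sum>p\<in>S. \<Sum>q\<in>S. of_real (w p) * of_real (w q) * ei (of_int (int j - d p - d q) * x))"
    proof (intro sum.cong refl)
      fix x
      have "complex_of_real (N x) * of_real (N x) * ei (real j * x)
        = (\<Sum>p\<in>S. \<Sum>q\<in>S. (of_real (w p) * ei (- (of_int (d p) * x))) * (of_real (w q) * ei (- (of_int (d q) * x))) * ei (real j * x))"
        by (simp only: N_def sq sum_product) (simp only: sum_distrib_right)
      also have "\<dots> = (\<Sum>p\<in>S. \<Sum>q\<in>S. of_real (w p) * of_real (w q) * ei (of_int (int j - d p - d q) * x))"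
      proof (intro sum.cong refl)
        fix p q
        have "of_int (int j - d p - d q) * x = - (of_int (d p) * x) + - (of_int (d q) * x) + real j * x"
          by (simp add: algebra_simps)
        then show "(of_real (w p) * ei (- (of_int (d p) * x))) * (of_real (w q) * ei (- (of_int (d q) * x))) * ei (real j * x)
            = of_real (w p) * of_real (w q) * ei (of_int (int j - d p - d q) * x)"
          by (simp only: ei_add mult_ac)
      qed
      finally show "complex_of_real (N x) * of_real (N x) * ei (real j * x) = \<dots>" .
    qed
    also have "\<dots> = (\<Sum>p\<in>S. \<Sum>q\<in>S. of_real (w p) * of_real (w q) * (\<Sum>x\<in>\<theta> ` {..<4*n}. ei (of_int (int j - d p - d q) * x)))"
      by (subst sum.swap, intro sum.cong refl, subst sum.swap) (simp add: sum_distrib_left)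
    also have "\<dots> = 0"
      by (intro sum.neutral ballI vanish)
    finally have "Re (\<Sum>x\<in>\<theta> ` {..<4*n}. complex_of_real (N x) * of_real (N x) * ei (real j * x)) = 0"
      by simp
    then have zero_sum: "(\<Sum>x\<in>\<theta> ` {..<4*n}. (N x)\<^sup>2 * Re (ei (real j * x))) = 0"
      by (simp add: power2_eq_square flip: of_real_mult)
    have Nnn: "N x \<ge> 0" for x by (simp add: N_def)
    \<comment> \<open>The added multiple of \<open>N x\<close> makes every summand nonnegative: on
      \<open>K\<close> the phases have nonnegative real part, and off \<open>K\<close> the addition
      outweighs the negative part. So the term at 0 is a lower bound.\<close>
    have "(\<Sum>x\<in>\<theta> ` {..<4*n}. (N x)\<^sup>2 * Re (ei (real j * x)) + (\<eta> * n)\<^sup>2 * N x)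
        \<ge> (\<Sum>x\<in>{0}. (N x)\<^sup>2 * Re (ei (real j * x)))"
    proof (rule order_trans[OF _ sum_mono2])
      show "finite (\<theta> ` {..<4*n})" "{0} \<subseteq> \<theta> ` {..<4*n}" using zero by auto
      show "(\<Sum>x\<in>{0}. (N x)\<^sup>2 * Re (ei (real j * x)))
          \<le> (\<Sum>x\<in>{0}. (N x)\<^sup>2 * Re (ei (real j * x)) + (\<eta> * n)\<^sup>2 * N x)"
        using Nnn by simp
      fix x assume "x \<in> \<theta> ` {..<4*n} - {0}"
      show "0 \<le> (N x)\<^sup>2 * Re (ei (real j * x)) + (\<eta> * n)\<^sup>2 * N x"
      proof (cases "x \<in> K")
        case True
        then show ?thesis using pos Nnn by (intro add_nonneg_nonneg mult_nonneg_nonneg) auto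
      next
        case False
        then have "norm (U x) < \<eta> * n"
          using \<open>x \<in> \<theta> ` {..<4*n} - {0}\<close> by (auto simp: K_def \<eta>_def)
        then have "N x \<le> (\<eta> * n)\<^sup>2" unfolding N_def by (intro power_mono) auto
        then have "N x * N x \<le> (\<eta> * n)\<^sup>2 * N x" using Nnn by (intro mult_right_mono)
        moreover have "(N x)\<^sup>2 * Re (ei (real j * x)) \<ge> (N x)\<^sup>2 * (-1)"
          using abs_Re_le_cmod[of "ei (real j * x)"] by (intro mult_left_mono) auto
        ultimately show ?thesis by (simp add: power2_eq_square)
      qed
    qed
    then have "(N 0)\<^sup>2 \<le> (\<eta> * n)\<^sup>2 * (\<Sum>x\<in>\<theta> ` {..<4*n}. N x)"
      using zero_sum by (simp add: sum.distrib sum_distrib_left)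
    also have "\<dots> \<le> (\<eta> * n)\<^sup>2 * (4 * (real n)\<^sup>2)"
      using parseval by (intro mult_left_mono) (auto simp: N_def)
    also have "\<dots> = (c * n) ^ 4 / 4"
      by (simp add: \<eta>_def power2_eq_square power4_eq_xxxx)
    also have "\<dots> < (c * n) ^ 4" using c n by simp
    also have "\<dots> \<le> norm (U 0) ^ 4" using U0 c by (intro power_mono) auto
    also have "\<dots> = (N 0)\<^sup>2" by (simp add: N_def flip: power_mult)
    finally show False by simp
  qed
qed


section \<open>Exponential sums on time grids\<close>

text \<open>The covered time splits into \<open>Q\<close> blocks of length \<open>B\<close>. Each
  contains a return time \<tau> followed by a stretch of length \<open>1 / \<rho>\<close>, on which
  \<open>p\<close> grid points have weight at least 1/2; \<open>L + 1 \<le> real B\<close> keeps the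
  stretch inside the block.\<close>

lemma sum_grid_lower_bound:
  fixes u :: "real \<Rightarrow> real" and B \<rho> p Q :: nat
  assumes nonneg: "\<And>t. 0 \<le> u t" and pos: "\<rho> > 0" "p > 0" and B: "L + 1 \<le> real B"
    and rd: "\<And>r. \<exists>\<tau>. r < \<tau> \<and> \<tau> < r + L \<and> (\<forall>s. 0 \<le> s \<and> s < 1 / \<rho> \<longrightarrow> 1/2 \<le> u (\<tau> + s))"
  shows "real Q * real p / 2 \<le> (\<Sum>a<Q * (B * \<rho> * p). u (real a / (real \<rho> * real p)))"
proof -
  define b where "b = B * \<rho> * p"
  define M where "M = real \<rho> * real p"
  have M: "M > 0" and pM: "real p \<le> M" using pos by (auto simp: M_def)
  define v where "v a = u (real a / M)" for a :: nat
  have block: "real p / 2 \<le> (\<Sum>a = i * b..<i * b + b. v a)" for i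
  proof -
    obtain \<tau> where t: "real (i * B) < \<tau>" "\<tau> < real (i * B) + L"
      and ut: "\<And>s. 0 \<le> s \<Longrightarrow> s < 1 / \<rho> \<Longrightarrow> 1/2 \<le> u (\<tau> + s)"
      using rd[of "real (i * B)"] by auto
    \<comment> \<open>The first grid index at or after time \<tau>; the run of \<open>p\<close>
      points starts here.\<close>
    define a0 where "a0 = nat \<lceil>\<tau> * M\<rceil>"
    have "\<tau> > 0" using t(1) by (meson le_less_trans of_nat_0_le_iff)
    then have "\<tau> * M > 0" using M by simp
    then have a0: "\<tau> * M \<le> real a0" "real a0 < \<tau> * M + 1"
      unfolding a0_def by linarith+
    have mem: "i * b \<le> a \<and> a < i * b + b \<and> 1/2 \<le> v a" if "a \<in> {a0..<a0 + p}" for a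
    proof -
      have a: "\<tau> * M \<le> real a" "real a < \<tau> * M + p"
        using that a0 by auto
      have "real (i * B) * M < \<tau> * M" using t M by simp
      then have "real (i * b) < real a"
        using a by (simp add: b_def M_def mult_ac)
      then have lower: "i * b < a" by (simp only: of_nat_less_iff)
      have "\<tau> * M \<le> (real (i * B) + (real B - 1)) * M"
        using t B M by (intro mult_right_mono) auto
      moreover have "(real (i * B) + (real B - 1)) * M + M = real (i * b + b)"
        by (simp add: b_def M_def algebra_simps)
      ultimately have "real a < real (i * b + b)"
        using a pM by (simp add: distrib_right)
      then have "a < i * b + b" by (simp only: of_nat_less_iff)
      moreover have "1/2 \<le> u (\<tau> + (real a / M - \<tau>))"
      proof (rule ut)
        show "0 \<le> real a / M - \<tau>" using a M by (simp add: field_simps)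
        have "real a < (\<tau> + p / M) * M" using a M by (simp add: distrib_right)
        then have "real a / M < \<tau> + p / M" by (rule pos_divide_less_eq[OF M, THEN iffD2])
        then have "real a / M - \<tau> < p / M" by linarith
        then show "real a / M - \<tau> < 1 / \<rho>" using pos by (simp add: M_def)
      qed
      ultimately show ?thesis using lower by (simp add: v_def)
    qed
    have "real p / 2 = (\<Sum>a\<in>{a0..<a0 + p}. 1/2)" by simp
    also have "\<dots> \<le> (\<Sum>a\<in>{a0..<a0 + p}. v a)"
      using mem by (intro sum_mono) auto
    also have "\<dots> \<le> (\<Sum>a = i * b..<i * b + b. v a)"
    proof (rule sum_mono2)
      show "{a0..<a0 + p} \<subseteq> {i * b..<i * b + b}"
        using mem by (meson atLeastLessThan_iff subsetI)
    qed (use nonneg in \<open>auto simp: v_def\<close>)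
    finally show ?thesis .
  qed
  have "real Q * real p / 2 = (\<Sum>i<Q. real p / 2)" by simp
  also have "\<dots> \<le> (\<Sum>i<Q. \<Sum>a = i * b..<i * b + b. v a)"
    using block by (intro sum_mono)
  also have "\<dots> = (\<Sum>a<Q * b. v a)"
    by (rule sum.nat_group)
  finally show ?thesis by (simp add: v_def b_def M_def)
qed

text \<open>Sliding the window of summation by \<open>b\<close> affects only \<open>2 * b\<close>
  boundary terms, while it multiplies the sum by \<open>ei (- (real b * x))\<close> up to an error
  \<open>n * \<delta>\<close>. A large sum therefore forces \<open>real b * x\<close> to be nearly
  an integer.\<close>

lemma norm_exponential_sum_shift:
  fixes u :: "nat \<Rightarrow> real" and b n :: nat and x \<delta> :: real
  defines "A \<equiv> \<lambda>(n::nat) x. \<Sum>a<n. of_real (u a) * ei (- (real a * x))"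
  assumes u: "\<And>a. 0 \<le> u a" "\<And>a. u a \<le> 1" and \<delta>: "\<And>a. \<bar>u (a + b) - u a\<bar> \<le> \<delta>"
  shows "norm (A n x) * norm (ei (real b * x) - 1) \<le> n * \<delta> + 2 * b"
proof -
  define G where "G a = of_real (u a) * ei (- (real a * x))" for a
  have nG: "norm (G a) \<le> 1" for a
    using u[of a] by (simp add: G_def norm_mult)
  have norm_sum: "norm (\<Sum>a\<in>I. G a) \<le> card I" for I
    using sum_norm_bound[of I G 1] nG by simp
  have shift: "G (a + b) = ei (- (real b * x)) * (of_real (u (a + b)) * ei (- (real a * x)))" for a
  proof -
    have "ei (- (real (a + b) * x)) = ei (- (real b * x)) * ei (- (real a * x))"
      by (simp add: algebra_simps flip: ei_add)
    then show ?thesis by (simp add: G_def)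
  qed
  have "(\<Sum>a<n. G (a + b)) + (\<Sum>a<b. G a) = (\<Sum>a<n + b. G a)"
  proof -
    have "(\<Sum>a<n. G (a + b)) = (\<Sum>a = b..<n + b. G a)"
      using sum.shift_bounds_nat_ivl[of G 0 b n] by (simp add: atLeast0LessThan)
    moreover have "(\<Sum>a = 0..<b. G a) + (\<Sum>a = b..<n + b. G a) = (\<Sum>a = 0..<n + b. G a)"
      by (rule sum.atLeastLessThan_concat) auto
    ultimately show ?thesis by (simp add: atLeast0LessThan add.commute)
  qed
  moreover have "(\<Sum>a<n + b. G a) = A n x + (\<Sum>a = n..<n + b. G a)"
    using sum.atLeastLessThan_concat[of 0 n "n + b" G]
    by (simp add: A_def G_def atLeast0LessThan)
  ultimately have e1: "(\<Sum>a<n. G (a + b)) - A n x = (\<Sum>a = n..<n + b. G a) - (\<Sum>a<b. G a)"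
    by (simp add: algebra_simps)
  have e2: "(\<Sum>a<n. G (a + b)) - ei (- (real b * x)) * A n x
      = ei (- (real b * x)) * (\<Sum>a<n. of_real (u (a + b) - u a) * ei (- (real a * x)))"
    by (simp add: shift A_def sum_distrib_left algebra_simps flip: sum_subtractf)
  have "norm (\<Sum>a<n. of_real (u (a + b) - u a) * ei (- (real a * x))) \<le> (\<Sum>a<n. \<delta>)"
    using \<delta> by (intro sum_norm_le) (simp add: norm_mult flip: of_real_diff)
  then have n2: "norm ((\<Sum>a<n. G (a + b)) - ei (- (real b * x)) * A n x) \<le> n * \<delta>"
    by (simp add: e2 norm_mult)
  have n1: "norm ((\<Sum>a<n. G (a + b)) - A n x) \<le> 2 * b"
    using norm_triangle_ineq4[of "\<Sum>a = n..<n + b. G a" "\<Sum>a<b. G a"]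
      norm_sum[of "{n..<n+b}"] norm_sum[of "{..<b}"] by (simp add: e1)
  have "norm (A n x) * norm (ei (real b * x) - 1) = norm (A n x) * norm (ei (- (real b * x)) - 1)"
    by (simp add: norm_ei_minus)
  also have "\<dots> = norm (((\<Sum>a<n. G (a + b)) - A n x) - ((\<Sum>a<n. G (a + b)) - ei (- (real b * x)) * A n x))"
    by (simp add: algebra_simps flip: norm_mult)
  also have "\<dots> \<le> 2 * b + n * \<delta>"
    using norm_triangle_ineq4[of "(\<Sum>a<n. G (a + b)) - A n x" "(\<Sum>a<n. G (a + b)) - ei (- (real b * x)) * A n x"]
      n1 n2 by linarith
  finally show ?thesis by simp
qed

section \<open>Limiting frequencies and Bohr sets\<close>

lemma common_convergent_subsequence:
  fixes g :: "nat \<Rightarrow> nat \<Rightarrow> real"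
  assumes "\<And>N i. i < m \<Longrightarrow> \<bar>g N i\<bar> \<le> C"
  shows "\<exists>r l. strict_mono r \<and> (\<forall>i<m. (\<lambda>N. g (r N) i) \<longlonglongrightarrow> l i)"
  using assms
proof (induction m)
  case 0
  then show ?case by (auto intro!: exI[of _ "\<lambda>N. N"] simp: strict_mono_def)
next
  case (Suc m)
  then obtain r l where r: "strict_mono r" "\<And>i. i < m \<Longrightarrow> (\<lambda>N. g (r N) i) \<longlonglongrightarrow> l i"
    by (metis less_SucI)
  have "bounded (range (\<lambda>N. g (r N) m))"
    using Suc.prems by (auto simp: bounded_iff)
  from bounded_imp_convergent_subsequence[OF this]
  obtain y s where s: "strict_mono s" "((\<lambda>N. g (r N) m) \<circ> s) \<longlonglongrightarrow> y"
    by blast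
  have "(\<lambda>N. g ((r \<circ> s) N) i) \<longlonglongrightarrow> (l(m := y)) i" if "i < Suc m" for i
  proof (cases "i = m")
    case True
    then show ?thesis using s(2) by (simp add: o_def)
  next
    case False
    then have "i < m" using that by simp
    then show ?thesis
      using LIMSEQ_subseq_LIMSEQ[OF r(2) s(1), of i] False by (simp add: o_def)
  qed
  moreover have "strict_mono (r \<circ> s)"
    using r(1) s(1) by (rule strict_mono_o)
  ultimately show ?case by blast
qed

text \<open>Repetitions are allowed, so that frequency sets of varying size can all be indexed by
  the same \<open>{..<m}\<close>.\<close>

lemma enumerate_finite_set:
  assumes "finite K" "K \<noteq> {}" "card K \<le> m"
  obtains g :: "nat \<Rightarrow> 'a" where "g ` {..<m} = K"
proof -
  obtain f where f: "bij_betw f {0..<card K} K"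
    using ex_bij_betw_nat_finite[OF assms(1)] by blast
  obtain k where "k \<in> K" using assms(2) by blast
  define g where "g i = (if i < card K then f i else k)" for i
  have "g ` {..<m} \<subseteq> K"
    using f \<open>k \<in> K\<close> by (auto simp: g_def bij_betw_def)
  moreover have "K \<subseteq> g ` {..<m}"
  proof
    fix x assume "x \<in> K"
    then have "x \<in> f ` {0..<card K}"
      using f by (simp add: bij_betw_def)
    then obtain i where "i < card K" "x = f i"
      by auto
    then show "x \<in> g ` {..<m}" using assms(3) by (intro image_eqI[of _ _ i]) (auto simp: g_def)
  qed
  ultimately show ?thesis using that by blast
qed

text \<open>The frequencies in \<open>\<Lambda>\<close> are limits of large Fourier frequencies on the grids with step
  \<open>1 / M N\<close> and length \<open>n N\<close>, where the step tends to 0 and the covered time tends to infinity.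
  A Fourier coefficient of size \<open>\<eta>\<close> changes by little when the grid function is shifted by \<open>\<tau>\<close>
  with \<open>D \<tau>\<close> small, so its phase \<open>ei (x * \<tau>)\<close> is close to 1; this passes to the limit.\<close>

lemma bohr_neighbourhood:
  fixes D :: "real \<Rightarrow> real"
  assumes D0: "D 0 = 0" and sym: "\<And>t. D (- t) = D t" and tri: "\<And>s t. D (s + t) \<le> D s + D t"
    and cont: "\<And>\<epsilon>. \<epsilon> > 0 \<Longrightarrow> \<exists>\<delta>>0. \<forall>t. \<bar>t\<bar> < \<delta> \<longrightarrow> D t < \<epsilon>"
    and rd: "\<And>\<epsilon>. \<epsilon> > 0 \<Longrightarrow> relatively_dense {\<tau>. D \<tau> \<le> \<epsilon>}"
    and "\<epsilon> > 0"
  shows "\<exists>\<Lambda>. finite \<Lambda> \<and> (\<forall>\<nu>\<in>\<Lambda>. \<exists>C. \<forall>\<tau>. norm (ei (\<nu> * \<tau>) - 1) \<le> C * D \<tau>) \<and>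
    (\<forall>t. (\<forall>\<nu>\<in>\<Lambda>. Re (ei (\<nu> * t)) \<ge> 1/2) \<longrightarrow> D t \<le> \<epsilon>)"
proof -
  have Dnn: "D t \<ge> 0" for t
    using tri[of t "-t"] sym[of t] D0 by simp
  have Ddiff: "\<bar>D s - D t\<bar> \<le> D (s - t)" for s t
    using tri[of "s - t" t] tri[of "t - s" s] sym[of "s - t"] by (simp add: abs_le_iff)
  \<comment> \<open>Four portions pay for the four terms of a Bogolyubov representation, the fifth
    for rounding the time to the grid.\<close>
  define \<epsilon>' where "\<epsilon>' = \<epsilon> / 5"
  have e': "\<epsilon>' > 0" using \<open>\<epsilon> > 0\<close> by (simp add: \<epsilon>'_def)
  define u where "u t = max 0 (1 - D t / \<epsilon>')" for t
  have u: "0 \<le> u t" "u t \<le> 1" for t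
    using Dnn[of t] e' by (auto simp: u_def)
  have upos: "D t < \<epsilon>'" if "u t > 0" for t
    using that e' by (simp add: u_def max_def field_simps split: if_splits)
  have udiff: "\<bar>u s - u t\<bar> \<le> D (s - t) / \<epsilon>'" for s t
  proof -
    have "\<bar>u s - u t\<bar> \<le> \<bar>D s / \<epsilon>' - D t / \<epsilon>'\<bar>" by (auto simp: u_def)
    also have "\<dots> = \<bar>D s - D t\<bar> / \<epsilon>'" using e' by (simp flip: diff_divide_distrib)
    also have "\<dots> \<le> D (s - t) / \<epsilon>'" using e' Ddiff by (intro divide_right_mono) auto
    finally show ?thesis .
  qed
  obtain L where L: "L > 0" "\<And>r. \<exists>\<tau>. r < \<tau> \<and> \<tau> < r + L \<and> D \<tau> \<le> \<epsilon>' / 4"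
    using rd[of "\<epsilon>' / 4"] e' unfolding relatively_dense_def by fastforce
  obtain r0 where r0: "r0 > 0" "\<And>t. \<bar>t\<bar> < r0 \<Longrightarrow> D t < \<epsilon>' / 4"
    using cont[of "\<epsilon>' / 4"] e' by auto
  obtain \<rho> :: nat where \<rho>: "\<rho> > 0" "1 / \<rho> < r0"
    using ex_inverse_of_nat_less[OF r0(1)] by (auto simp: inverse_eq_divide)
  obtain B :: nat where B: "L + 1 \<le> real B" using real_arch_simple by blast
  have Bpos: "B > 0" using B L(1) by (cases B) auto
  \<comment> \<open>With step \<open>1 / M N\<close> and \<open>n N\<close> points the grid covers
    the time \<open>real B * real (Suc N)\<close>, so refinement and length grow together.\<close>
  define M where "M N = real \<rho> * real (Suc N)" for N :: nat
  define n where "n N = Suc N * (B * \<rho> * Suc N)" for N :: nat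
  have M: "M N > 0" for N using \<rho> by (simp add: M_def)
  have npos: "n N > 0" for N using \<rho> Bpos by (simp add: n_def)
  have nM: "real (n N) = M N * (real B * real (Suc N))" for N
    by (simp add: n_def M_def algebra_simps)
  \<comment> \<open>This density does not depend on \<open>N\<close>, which bounds the number of
    large frequencies uniformly in \<open>N\<close>.\<close>
  define c where "c = 1 / (2 * real B * real \<rho>)"
  have "real B \<ge> 1" "real \<rho> \<ge> 1" using Bpos \<rho> by auto
  then have "real B * real \<rho> \<ge> 1" using mult_mono[of 1 "real B" 1 "real \<rho>"] by simp
  then have c: "0 < c" "c \<le> 1" by (auto simp: c_def divide_simps)
  define v where "v N a = u (real a / M N)" for N a :: nat
  have mean: "(\<Sum>a<n N. v N a) \<ge> c * n N" for N
  proof -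
    have "real (Suc N) * real (Suc N) / 2 \<le> (\<Sum>a<Suc N * (B * \<rho> * Suc N). u (real a / (real \<rho> * real (Suc N))))"
    proof (rule sum_grid_lower_bound)
      show "0 \<le> u t" for t by (rule u)
      show "\<rho> > 0" "Suc N > 0" "L + 1 \<le> real B" using \<rho> B by auto
      fix r
      obtain \<tau> where t: "r < \<tau>" "\<tau> < r + L" "D \<tau> \<le> \<epsilon>' / 4" using L(2) by blast
      have "1/2 \<le> u (\<tau> + s)" if "0 \<le> s" "s < 1 / \<rho>" for s
      proof -
        have "D s < \<epsilon>' / 4" using that \<rho> by (intro r0(2)) auto
        then have "D (\<tau> + s) \<le> \<epsilon>' / 2" using tri[of \<tau> s] t(3) by linarith
        then have "D (\<tau> + s) / \<epsilon>' \<le> 1/2" using e' by (simp add: field_simps)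
        then show ?thesis unfolding u_def by (intro max.coboundedI2) linarith
      qed
      then show "\<exists>\<tau>. r < \<tau> \<and> \<tau> < r + L \<and> (\<forall>s. 0 \<le> s \<and> s < 1 / \<rho> \<longrightarrow> 1/2 \<le> u (\<tau> + s))"
        using t by blast
    qed
    moreover have "c * n N = real (Suc N) * real (Suc N) / 2"
      using Bpos \<rho> by (simp add: c_def n_def field_simps)
    ultimately show ?thesis by (simp add: v_def M_def n_def)
  qed
  define \<eta> where "\<eta> = c\<^sup>2 / 4"
  have \<eta>: "\<eta> > 0" using c by (simp add: \<eta>_def)
  define A where "A N x = (\<Sum>a<n N. of_real (v N a) * ei (- (real a * x)))" for N x
  define K where "K N = {x \<in> (\<lambda>k. (real k - 2 * real (n N)) / (4 * real (n N))) ` {..<4 * n N}.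
      norm (A N x) \<ge> c\<^sup>2 / 4 * n N}" for N
  have vb: "0 \<le> v N a" "v N a \<le> 1" for N a by (simp_all add: v_def u)
  note fb = finite_bogolyubov[OF npos c vb mean, folded A_def, folded K_def]
  have shift: "\<eta> * norm (ei (x * real b) - 1) \<le> D (b / M N) / \<epsilon>' + 2 * b / n N" if "x \<in> K N" for x :: real and N b :: nat
  proof -
    have "\<bar>v N (a + b) - v N a\<bar> \<le> D (b / M N) / \<epsilon>'" for a
      using udiff[of "real (a + b) / M N" "real a / M N"]
      by (simp add: v_def flip: diff_divide_distrib)
    from norm_exponential_sum_shift[of "v N", OF vb this, where n = "n N" and x = x]
    have "norm (A N x) * norm (ei (real b * x) - 1) \<le> n N * (D (b / M N) / \<epsilon>') + 2 * b"
      by (simp add: A_def)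
    moreover have "\<eta> * n N * norm (ei (real b * x) - 1) \<le> norm (A N x) * norm (ei (real b * x) - 1)"
      using that by (intro mult_right_mono) (auto simp: K_def \<eta>_def)
    ultimately have "\<eta> * n N * norm (ei (real b * x) - 1) \<le> n N * (D (b / M N) / \<epsilon>') + 2 * b"
      by linarith
    then have "(\<eta> * n N * norm (ei (real b * x) - 1)) / n N \<le> (n N * (D (b / M N) / \<epsilon>') + 2 * b) / n N"
      by (rule divide_right_mono) simp
    then show ?thesis using npos[of N] by (simp add: add_divide_distrib mult.commute)
  qed
  text \<open>Large Fourier coefficients live at bounded frequencies: at a high frequency some small
    shift of the grid changes the phase by at least a quarter turn.\<close>
  obtain r1 where r1: "r1 > 0" "\<And>t. \<bar>t\<bar> < r1 \<Longrightarrow> D t < \<eta> * \<epsilon>' / 4"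
    using cont[of "\<eta> * \<epsilon>' / 4"] e' \<eta> by auto
  \<comment> \<open>From \<open>N0\<close> on, shifts by less than the time \<open>r1\<close> have a
    boundary error \<open>2 * b / n N\<close> of at most \<open>\<eta> / 4\<close>.\<close>
  obtain N0 :: nat where N0: "8 * r1 / \<eta> < real N0" using reals_Archimedean2 by blast
  have bound: "\<bar>x * M N\<bar> \<le> 1 / r1" if x: "x \<in> K N" and N: "N \<ge> N0" for x :: real and N :: nat
  proof (rule ccontr)
    assume "\<not> ?thesis"
    then have large: "1 < r1 * (\<bar>x\<bar> * M N)" using r1 M[of N] by (simp add: abs_mult field_simps)
    then have xp: "\<bar>x\<bar> > 0" using r1 by (cases "x = 0") auto
    \<comment> \<open>Rounding 1 / (4 |x|) up keeps \<open>real b * \<bar>x\<bar>\<close> between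
      1/4 and 3/4, because |x| is at most 1/2.\<close>
    define b where "b = nat \<lceil>1 / (4 * \<bar>x\<bar>)\<rceil>"
    have "1 / (4 * \<bar>x\<bar>) > 0" using xp by simp
    then have b: "1 / (4 * \<bar>x\<bar>) \<le> real b" "real b < 1 / (4 * \<bar>x\<bar>) + 1"
      unfolding b_def by linarith+
    have "\<bar>x\<bar> \<le> 1/2" using fb(4)[OF x] .
    have bx: "1/4 \<le> real b * \<bar>x\<bar>" "real b * \<bar>x\<bar> < 3/4"
    proof -
      show "1/4 \<le> real b * \<bar>x\<bar>" using b(1) xp by (simp add: field_simps)
      have "real b * \<bar>x\<bar> < (1 / (4 * \<bar>x\<bar>) + 1) * \<bar>x\<bar>" using b(2) xp by (intro mult_strict_right_mono)
      also have "\<dots> = 1/4 + \<bar>x\<bar>" using xp by (simp add: field_simps)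
      finally show "real b * \<bar>x\<bar> < 3/4" using \<open>\<bar>x\<bar> \<le> 1/2\<close> by linarith
    qed
    have "1 \<le> norm (ei (x * real b) - 1)"
      using bx by (intro norm_ei_ge_1) (auto simp: abs_mult mult.commute)
    then have "\<eta> * 1 \<le> \<eta> * norm (ei (x * real b) - 1)" using \<eta> by (intro mult_left_mono) auto
    with shift[OF x, of b] have s: "\<eta> \<le> D (b / M N) / \<epsilon>' + 2 * b / n N" by linarith
    have "real b * \<bar>x\<bar> < (r1 * M N) * \<bar>x\<bar>" using bx large by (simp add: mult_ac)
    then have bM: "b < r1 * M N" using xp by simp
    then have "b / M N < r1" using M[of N] by (simp add: field_simps)
    then have "D (b / M N) < \<eta> * \<epsilon>' / 4" using M[of N] by (intro r1(2)) auto
    then have "D (b / M N) / \<epsilon>' < \<eta> / 4" using e' by (simp add: field_simps)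
    moreover have "2 * b / n N \<le> \<eta> / 4"
    proof -
      have "8 * r1 < \<eta> * real N0" using N0 \<eta> by (simp add: field_simps)
      also have "\<dots> \<le> \<eta> * real (Suc N)" using N \<eta> by (intro mult_left_mono) auto
      finally have "8 * r1 \<le> \<eta> * real (Suc N)" by simp
      have "8 * real b \<le> 8 * r1 * M N" using bM by simp
      also have "\<dots> \<le> \<eta> * real (Suc N) * M N"
        using \<open>8 * r1 \<le> \<eta> * real (Suc N)\<close> M[of N] by (intro mult_right_mono) auto
      also have "\<dots> = \<eta> * 1 * (real (Suc N) * M N)" by simp
      also have "\<dots> \<le> \<eta> * real B * (real (Suc N) * M N)"
        using \<open>real B \<ge> 1\<close> \<eta> M[of N] by (intro mult_right_mono mult_left_mono) auto
      also have "\<dots> = \<eta> * n N" by (simp add: nM)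
      finally show ?thesis using npos[of N] by (simp add: field_simps)
    qed
    ultimately show False using s \<eta> by linarith
  qed
  obtain m :: nat where m: "64 / c ^ 4 \<le> real m" using real_arch_simple by blast
  have "\<exists>g. g ` {..<m} = K (N + N0)" for N
  proof -
    have "real (card (K (N + N0))) \<le> real m" using fb(3)[of "N + N0"] m by linarith
    then show ?thesis using enumerate_finite_set[of "K (N + N0)" m] fb(1,2)[of "N + N0"] by (metis empty_iff of_nat_le_iff)
  qed
  then obtain G where G: "\<And>N. G N ` {..<m} = K (N + N0)" by metis
  \<comment> \<open>Multiplication by \<open>M\<close> turns a frequency per grid step into a
    frequency per unit of time; these stay bounded.\<close>
  define g where "g N i = G N i * M (N + N0)" for N i
  have "\<bar>g N i\<bar> \<le> 1 / r1" if "i < m" for N i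
    using bound[of "G N i" "N + N0"] G[of N] that by (auto simp: g_def)
  then obtain r l where r: "strict_mono r" and l: "\<And>i. i < m \<Longrightarrow> (\<lambda>N. g (r N) i) \<longlonglongrightarrow> l i"
    using common_convergent_subsequence by metis
  \<comment> \<open>The offset \<open>N0\<close> keeps to the grids for which the frequency bound
    holds.\<close>
  define R where "R N = r N + N0" for N
  have R: "N \<le> R N" for N using seq_suble[OF r, of N] by (simp add: R_def)
  have Suc_lim: "filterlim (\<lambda>N. real (Suc (R N))) at_top sequentially"
    by (rule filterlim_at_top_mono[OF filterlim_real_sequentially]) (use R in \<open>auto intro!: always_eventually simp: le_Suc_eq simp flip: of_nat_Suc\<close>)
  have M_lim: "filterlim (\<lambda>N. M (R N)) at_top sequentially"
    unfolding M_def using \<rho> Suc_lim by (intro filterlim_tendsto_pos_mult_at_top[OF tendsto_const]) auto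
  \<comment> \<open>For nonnegative \<open>t\<close>, the last grid index not beyond time
    \<open>t\<close>.\<close>
  define b where "b t N = nat \<lfloor>t * M (R N)\<rfloor>" for t N
  have b: "real (b t N) \<le> t * M (R N)" "t * M (R N) - 1 < real (b t N)" if "t \<ge> 0" for t N
  proof -
    have "t * M (R N) \<ge> 0" using that M[of "R N"] by simp
    then show "real (b t N) \<le> t * M (R N)" "t * M (R N) - 1 < real (b t N)"
      unfolding b_def by linarith+
  qed
  have bM_lim: "(\<lambda>N. b t N / M (R N)) \<longlonglongrightarrow> t" if "t \<ge> 0" for t
  proof (rule tendsto_sandwich)
    have "t - 1 / M (R N) \<le> b t N / M (R N)" for N
    proof -
      have "t - 1 / M (R N) = (t * M (R N) - 1) / M (R N)"
        using M[of "R N"] by (simp add: diff_divide_distrib)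
      also have "\<dots> \<le> b t N / M (R N)"
        using b(2)[OF that, of N] M[of "R N"] by (intro divide_right_mono) auto
      finally show ?thesis .
    qed
    then show "\<forall>\<^sub>F N in sequentially. t - 1 / M (R N) \<le> b t N / M (R N)"
      by simp
    show "\<forall>\<^sub>F N in sequentially. b t N / M (R N) \<le> t"
      using b[OF that] M by (intro always_eventually allI) (simp add: field_simps)
    have "(\<lambda>N. t - 1 / M (R N)) \<longlonglongrightarrow> t - 0"
      by (intro tendsto_intros real_tendsto_divide_at_top[OF tendsto_const M_lim])
    then show "(\<lambda>N. t - 1 / M (R N)) \<longlonglongrightarrow> t" by simp
  qed simp
  have gb: "G (r N) i * b t N = g (r N) i * (b t N / M (R N))" for N i t
    using M[of "R N"] by (simp add: g_def R_def)
  have phase_lim: "(\<lambda>N. G (r N) i * b t N) \<longlonglongrightarrow> l i * t" if "t \<ge> 0" "i < m" for i t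
    unfolding gb by (intro tendsto_mult l bM_lim that)
  have D_lim: "(\<lambda>N. D (t - b t N / M (R N))) \<longlonglongrightarrow> 0" if t: "t \<ge> 0" for t
  proof (rule LIMSEQ_I)
    fix e :: real assume "e > 0"
    then obtain \<delta> where d: "\<delta> > 0" "\<And>t. \<bar>t\<bar> < \<delta> \<Longrightarrow> D t < e" using cont by blast
    obtain N1 where "\<And>N. N \<ge> N1 \<Longrightarrow> \<bar>b t N / M (R N) - t\<bar> < \<delta>"
      using LIMSEQ_D[OF bM_lim[OF t] d(1)] by auto
    then show "\<exists>N1. \<forall>N\<ge>N1. norm (D (t - b t N / M (R N)) - 0) < e"
      using d(2) Dnn by (intro exI[of _ N1]) (auto simp: abs_minus_commute)
  qed
  \<comment> \<open>On each grid \<open>shift\<close> bounds the phase by \<open>D\<close> up to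
    errors that vanish in the limit, which leaves a Lipschitz bound for the limiting
    frequency.\<close>
  have exponent: "norm (ei (l i * t) - 1) \<le> 1 / (\<eta> * \<epsilon>') * D t" if "i < m" "t \<ge> 0" for i t
  proof -
    have "\<eta> * norm (ei (l i * t) - 1) \<le> (D t + 0) / \<epsilon>' + 0"
    proof (rule LIMSEQ_le)
      show "(\<lambda>N. \<eta> * norm (ei (G (r N) i * b t N) - 1)) \<longlonglongrightarrow> \<eta> * norm (ei (l i * t) - 1)"
        by (intro tendsto_intros tendsto_ei phase_lim that)
      have "(\<lambda>N. (2 * t / B) / real (Suc (R N))) \<longlonglongrightarrow> 0"
        by (intro real_tendsto_divide_at_top[OF tendsto_const Suc_lim])
      then show "(\<lambda>N. (D t + D (t - b t N / M (R N))) / \<epsilon>' + (2 * t / B) / real (Suc (R N))) \<longlonglongrightarrow> (D t + 0) / \<epsilon>' + 0"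
        using e' by (intro tendsto_intros D_lim that) auto
      have "\<eta> * norm (ei (G (r N) i * b t N) - 1)
          \<le> (D t + D (t - b t N / M (R N))) / \<epsilon>' + (2 * t / B) / real (Suc (R N))" for N
      proof -
        have "G (r N) i \<in> K (R N)" using G[of "r N"] that by (auto simp: R_def)
        from shift[OF this, of "b t N"]
        have "\<eta> * norm (ei (G (r N) i * b t N) - 1) \<le> D (b t N / M (R N)) / \<epsilon>' + 2 * b t N / n (R N)" .
        moreover have "D (b t N / M (R N)) / \<epsilon>' \<le> (D t + D (t - b t N / M (R N))) / \<epsilon>'"
          using e' Ddiff[of t "b t N / M (R N)"] by (intro divide_right_mono) auto
        moreover have "2 * b t N / n (R N) \<le> (2 * t / B) / real (Suc (R N))"
        proof -
          have "2 * real (b t N) / n (R N) \<le> 2 * (t * M (R N)) / n (R N)"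
            using b(1)[OF that(2), of N] by (intro divide_right_mono) auto
          also have "\<dots> = (2 * t / B) / real (Suc (R N))"
            using M[of "R N"] by (simp add: nM)
          finally show ?thesis by simp
        qed
        ultimately show ?thesis by linarith
      qed
      then show "\<exists>N1. \<forall>N\<ge>N1. \<eta> * norm (ei (G (r N) i * b t N) - 1)
          \<le> (D t + D (t - b t N / M (R N))) / \<epsilon>' + (2 * t / B) / real (Suc (R N))" by blast
    qed
    then show ?thesis using \<eta> e' by (simp add: field_simps)
  qed
  \<comment> \<open>Real parts of at least 1/2 in the limit leave room for positive real parts on
    all late grids, so \<open>finite_bogolyubov\<close> applies there to the index of
    \<open>t\<close>.\<close>
  have small: "D t \<le> \<epsilon>" if "t \<ge> 0" "\<And>i. i < m \<Longrightarrow> Re (ei (l i * t)) \<ge> 1/2" for t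
  proof -
    have "\<forall>\<^sub>F N in sequentially. \<forall>i\<in>{..<m}. Re (ei (G (r N) i * b t N)) > 0"
    proof (rule eventually_ball_finite[OF finite_lessThan], intro ballI)
      fix i assume "i \<in> {..<m}"
      then have "i < m" by simp
      have "(\<lambda>N. Re (ei (G (r N) i * b t N))) \<longlonglongrightarrow> Re (ei (l i * t))"
        by (intro tendsto_Re tendsto_ei phase_lim \<open>i < m\<close> that(1))
      then show "\<forall>\<^sub>F N in sequentially. Re (ei (G (r N) i * b t N)) > 0"
        using that(2)[OF \<open>i < m\<close>] by (intro order_tendstoD(1)[where y = "Re (ei (l i * t))"]) auto
    qed
    moreover have "\<forall>\<^sub>F N in sequentially. D (t - b t N / M (R N)) < \<epsilon>'"
      using order_tendstoD(2)[OF D_lim[OF that(1)] e'] .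
    moreover have "\<forall>\<^sub>F N in sequentially. t < real (Suc (R N))"
      using Suc_lim by (simp add: filterlim_at_top_dense)
    ultimately have "\<forall>\<^sub>F N in sequentially. D t \<le> \<epsilon>"
    proof eventually_elim
      case (elim N)
      \<comment> \<open>A long enough grid keeps the index of \<open>t\<close> in the range without
        wrap-around.\<close>
      have "b t N < 2 * n (R N)"
      proof -
        have "real (b t N) \<le> t * M (R N)" using b that by auto
        also have "\<dots> \<le> real (Suc (R N)) * M (R N)"
          using elim M[of "R N"] by (intro mult_right_mono) auto
        also have "\<dots> \<le> real B * (real (Suc (R N)) * M (R N))"
          using \<open>real B \<ge> 1\<close> M[of "R N"] mult_right_mono[of 1 "real B" "real (Suc (R N)) * M (R N)"] by simp
        also have "\<dots> = n (R N)" by (simp add: nM)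
        also have "\<dots> < 2 * n (R N)" using npos by simp
        finally show ?thesis by linarith
      qed
      moreover have "Re (ei (real (b t N) * x)) \<ge> 0" if "x \<in> K (R N)" for x
      proof -
        obtain i where "i < m" "x = G (r N) i"
          using \<open>x \<in> K (R N)\<close> G[of "r N"] by (auto simp: R_def)
        then show ?thesis using elim(1) by (simp add: mult.commute less_imp_le)
      qed
      ultimately obtain a1 a2 a3 a4 where pos: "v (R N) a1 > 0" "v (R N) a2 > 0" "v (R N) a3 > 0" "v (R N) a4 > 0"
        and eq: "int (b t N) = int a1 - int a2 + int a3 - int a4"
        using fb(5) by blast
      let ?f = "\<lambda>a. real a / M (R N)"
      have Dp: "D (?f a) < \<epsilon>'" if "v (R N) a > 0" for a
        using that by (intro upos) (simp add: v_def)
      have "real (b t N) = real a1 - real a2 + real a3 - real a4"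
        using arg_cong[OF eq, of real_of_int] by simp
      then have bsum: "b t N / M (R N) = ?f a1 + (- ?f a2 + (?f a3 + - ?f a4))"
        by (simp add: diff_divide_distrib add_divide_distrib)
      have "D (b t N / M (R N)) \<le> D (?f a1) + D (?f a2) + D (?f a3) + D (?f a4)"
        unfolding bsum using tri[of "?f a1" "- ?f a2 + (?f a3 + - ?f a4)"] tri[of "- ?f a2" "?f a3 + - ?f a4"]
          tri[of "?f a3" "- ?f a4"] sym[of "?f a2"] sym[of "?f a4"] by linarith
      then have "D (b t N / M (R N)) < 4 * \<epsilon>'" using Dp[OF pos(1)] Dp[OF pos(2)] Dp[OF pos(3)] Dp[OF pos(4)] by linarith
      moreover have "D t \<le> D (t - b t N / M (R N)) + D (b t N / M (R N))"
        using tri[of "t - b t N / M (R N)" "b t N / M (R N)"] by simp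
      ultimately show ?case using elim(2) by (simp add: \<epsilon>'_def)
    qed
    then show ?thesis by simp
  qed
  show ?thesis
  proof (intro exI[of _ "l ` {..<m}"] conjI ballI allI impI)
    fix \<nu> assume "\<nu> \<in> l ` {..<m}"
    then obtain i where i: "i < m" "\<nu> = l i" by auto
    have "norm (ei (\<nu> * \<tau>) - 1) \<le> 1 / (\<eta> * \<epsilon>') * D \<tau>" for \<tau>
      using exponent[OF i(1), of \<tau>] exponent[OF i(1), of "- \<tau>"] norm_ei_minus[of "\<nu> * \<tau>"]
      by (cases "\<tau> \<ge> 0") (auto simp: i(2) sym)
    then show "\<exists>C. \<forall>\<tau>. norm (ei (\<nu> * \<tau>) - 1) \<le> C * D \<tau>" by blast
  next
    fix t assume *: "\<forall>\<nu>\<in>l ` {..<m}. 1/2 \<le> Re (ei (\<nu> * t))"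
    then show "D t \<le> \<epsilon>"
      using small[of t] small[of "- t"] by (cases "t \<ge> 0") (auto simp: sym Re_ei_minus)
  qed simp
qed


section \<open>Minimal almost periodic flows\<close>

text \<open>A real supremum, meaningful for bounded distances; for the flows below, compactness of
  the space provides the bound.\<close>

definition displacement :: "(real \<Rightarrow> 'a::metric_space \<Rightarrow> 'a) \<Rightarrow> real \<Rightarrow> real" where
  "displacement \<phi> \<tau> = (SUP x. dist x (\<phi> \<tau> x))"

text \<open>A description of the exponents that involves no base point.\<close>

definition characters :: "(real \<Rightarrow> 'a::metric_space \<Rightarrow> 'a) \<Rightarrow> real set" where
  "characters \<phi> = {\<alpha>. \<forall>\<epsilon>>0. \<exists>\<delta>>0. \<forall>\<tau>. displacement \<phi> \<tau> < \<delta> \<longrightarrow> norm (ei (\<alpha> * \<tau>) - 1) < \<epsilon>}"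

lemma relatively_dense_mono: "relatively_dense S \<Longrightarrow> S \<subseteq> T \<Longrightarrow> relatively_dense T"
  unfolding relatively_dense_def by blast

context
  fixes \<phi> :: "real \<Rightarrow> 'a::complete_space \<Rightarrow> 'a"
  assumes map: "minimal_almost_periodic_flow \<phi>"
begin

lemma flow_continuous: "continuous_on S (\<lambda>(t, x). \<phi> t x)"
  using map continuous_on_subset[of UNIV] by (auto simp: minimal_almost_periodic_flow_def flow_def)

lemma flow_continuous_compose:
  "continuous_on S f \<Longrightarrow> continuous_on S g \<Longrightarrow> continuous_on S (\<lambda>z. \<phi> (f z) (g z))"
  using continuous_on_compose2[OF flow_continuous[of UNIV], of S "\<lambda>z. (f z, g z)"]
  by (auto intro: continuous_on_Pair)

lemma flow_0: "\<phi> 0 x = x"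
  using map by (auto simp: minimal_almost_periodic_flow_def flow_def)

lemma flow_add: "\<phi> (s + t) x = \<phi> s (\<phi> t x)"
  using map by (auto simp: minimal_almost_periodic_flow_def flow_def)

lemma flow_diff: "\<phi> (s - t) (\<phi> t x) = \<phi> s x"
  using flow_add[of "s - t" t x] by simp

lemma orbit_dense: "closure (range (\<lambda>t. \<phi> t x)) = UNIV"
  using map by (auto simp: minimal_almost_periodic_flow_def orbit_map_def)

text \<open>Closed conditions on a point need checking along one orbit only. Identities and
  estimates are extended to the whole space in this way.\<close>

lemma closed_contains_orbit:
  assumes "closed S" "\<And>t. \<phi> t x \<in> S"
  shows "y \<in> S"
  using closure_minimal[of "range (\<lambda>t. \<phi> t x)" S] assms orbit_dense by blast

text \<open>The bound along one orbit is a closed condition on the point, so it spreads to the whole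
  space: near-periods serve all points at once.\<close>

lemma near_return_times:
  assumes "\<epsilon> > 0"
  shows "relatively_dense {\<tau>. \<forall>x. dist x (\<phi> \<tau> x) \<le> \<epsilon>}"
proof -
  fix x0 :: 'a
  have "relatively_dense {\<tau>. (SUP t. ereal (dist (\<phi> t x0) (\<phi> (t + \<tau>) x0))) \<le> ereal \<epsilon>}"
    using map assms by (auto simp: minimal_almost_periodic_flow_def almost_periodic_def orbit_map_def)
  then show ?thesis
  proof (rule relatively_dense_mono, safe)
    fix \<tau> x
    assume "(SUP t. ereal (dist (\<phi> t x0) (\<phi> (t + \<tau>) x0))) \<le> ereal \<epsilon>"
    then have *: "dist (\<phi> t x0) (\<phi> (t + \<tau>) x0) \<le> \<epsilon>" for t
      by (simp add: SUP_le_iff)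
    have "x \<in> {x. dist x (\<phi> \<tau> x) \<le> \<epsilon>}"
    proof (rule closed_contains_orbit[of _ x0])
      show "closed {x. dist x (\<phi> \<tau> x) \<le> \<epsilon>}"
        by (intro closed_Collect_le flow_continuous_compose continuous_intros)
      show "\<phi> t x0 \<in> {x. dist x (\<phi> \<tau> x) \<le> \<epsilon>}" for t
        using *[of t] by (simp add: flow_add[symmetric] add.commute)
    qed
    then show "dist x (\<phi> \<tau> x) \<le> \<epsilon>" by simp
  qed
qed

lemma near_return_time:
  assumes "\<epsilon> > 0"
  obtains L where "L > 0"
    "\<And>r. \<exists>\<tau>. r < \<tau> \<and> \<tau> < r + L \<and> (\<forall>x. dist x (\<phi> \<tau> x) \<le> \<epsilon>)"
  using near_return_times[OF assms] unfolding relatively_dense_def by fastforce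

section \<open>Compactness and equicontinuity\<close>

text \<open>A finite net for the orbit segment over \<open>{0..L}\<close> is nearly a net for the
  whole orbit, since a near-period moves any time into that segment at small cost. Density and
  completeness do the rest.\<close>

lemma compact_space: "compact (UNIV :: 'a set)"
  unfolding compact_eq_totally_bounded
proof (intro conjI allI impI)
  show "complete (UNIV :: 'a set)" by (rule complete_UNIV)
  fix \<epsilon> :: real assume "\<epsilon> > 0"
  fix x0 :: 'a
  obtain L where "L > 0" and L: "\<And>r. \<exists>\<tau>. r < \<tau> \<and> \<tau> < r + L \<and> (\<forall>x. dist x (\<phi> \<tau> x) \<le> \<epsilon> / 3)"
    by (rule near_return_time[of "\<epsilon> / 3"]) (use \<open>\<epsilon> > 0\<close> in auto)
  have "compact ((\<lambda>s. \<phi> s x0) ` {0..L})"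
    by (intro compact_continuous_image flow_continuous_compose continuous_intros compact_Icc)
  then have "\<forall>e>0. \<exists>k. finite k \<and> (\<lambda>s. \<phi> s x0) ` {0..L} \<subseteq> (\<Union>z\<in>k. ball z e)"
    unfolding compact_eq_totally_bounded by (rule conjunct2)
  from this[rule_format, of "\<epsilon> / 3"] obtain k
    where k: "finite k" "(\<lambda>s. \<phi> s x0) ` {0..L} \<subseteq> (\<Union>z\<in>k. ball z (\<epsilon> / 3))"
    using \<open>\<epsilon> > 0\<close> by auto
  \<comment> \<open>Closed balls make the finite union closed, as the density argument requires;
    their radius still leaves room below \<epsilon>.\<close>
  have "y \<in> (\<Union>z\<in>k. cball z (2 * \<epsilon> / 3))" for y
  proof (rule closed_contains_orbit[of _ x0])
    show "closed (\<Union>z\<in>k. cball z (2 * \<epsilon> / 3))" using k(1) by (intro closed_UN) auto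
    fix t
    obtain \<tau> where t: "- t < \<tau>" "\<tau> < - t + L" "\<And>x. dist x (\<phi> \<tau> x) \<le> \<epsilon> / 3" using L by blast
    then have "\<phi> (\<tau> + t) x0 \<in> (\<Union>z\<in>k. ball z (\<epsilon> / 3))"
      using subsetD[OF k(2) imageI[of "\<tau> + t" "{0..L}"]] by simp
    then obtain z where "z \<in> k" "dist z (\<phi> (\<tau> + t) x0) < \<epsilon> / 3" by auto
    moreover have "dist (\<phi> t x0) (\<phi> (\<tau> + t) x0) \<le> \<epsilon> / 3" using t(3) by (simp add: flow_add)
    ultimately have "dist z (\<phi> t x0) \<le> 2 * \<epsilon> / 3"
      using dist_triangle2[of z "\<phi> t x0" "\<phi> (\<tau> + t) x0"] by linarith
    then show "\<phi> t x0 \<in> (\<Union>z\<in>k. cball z (2 * \<epsilon> / 3))" using \<open>z \<in> k\<close> by auto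
  qed
  moreover have "cball z (2 * \<epsilon> / 3) \<subseteq> ball z \<epsilon>" for z :: 'a
    using \<open>\<epsilon> > 0\<close> by auto
  ultimately have "UNIV \<subseteq> (\<Union>z\<in>k. ball z \<epsilon>)" by blast
  then show "\<exists>k. finite k \<and> (UNIV :: 'a set) \<subseteq> (\<Union>z\<in>k. ball z \<epsilon>)" using k(1) by blast
qed

lemma uniformly_continuous_flow:
  assumes "\<epsilon> > 0"
  obtains \<delta> where "\<delta> > 0" "\<And>s t x y. s \<in> {a..b} \<Longrightarrow> t \<in> {a..b} \<Longrightarrow> \<bar>s - t\<bar> < \<delta> \<Longrightarrow> dist x y < \<delta> \<Longrightarrow>
    dist (\<phi> s x) (\<phi> t y) < \<epsilon>"
proof -
  have "uniformly_continuous_on ({a..b} \<times> UNIV) (\<lambda>(t, x). \<phi> t x)"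
    by (intro compact_uniformly_continuous flow_continuous compact_Times compact_Icc compact_space)
  from uniformly_continuous_onE[OF this assms] obtain \<delta> where d: "\<delta> > 0"
    "\<And>p q. p \<in> {a..b} \<times> UNIV \<Longrightarrow> q \<in> {a..b} \<times> UNIV \<Longrightarrow> dist q p < \<delta> \<Longrightarrow>
      dist ((\<lambda>(t, x). \<phi> t x) q) ((\<lambda>(t, x). \<phi> t x) p) < \<epsilon>"
    by blast
  have "dist (\<phi> s x) (\<phi> t y) < \<epsilon>"
    if "s \<in> {a..b}" "t \<in> {a..b}" "\<bar>s - t\<bar> < \<delta> / 2" "dist x y < \<delta> / 2" for s t x y
  proof -
    have "dist (s, x) (t, y) \<le> dist s t + dist x y"
      by (simp add: dist_Pair_Pair sqrt_sum_squares_le_sum)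
    then have "dist (s, x) (t, y) < \<delta>" using that by (simp add: dist_real_def)
    then show ?thesis using d(2)[of "(t, y)" "(s, x)"] that by auto
  qed
  moreover have "\<delta> / 2 > 0" using d(1) by simp
  ultimately show ?thesis using that by blast
qed

text \<open>Uniform continuity holds over the compact time interval \<open>{0..L}\<close>, and a
  near-period carries any other time into it while moving both points little.\<close>

lemma equicontinuous_flow:
  assumes "\<epsilon> > 0"
  obtains \<delta> where "\<delta> > 0" "\<And>s x y. dist x y < \<delta> \<Longrightarrow> dist (\<phi> s x) (\<phi> s y) < \<epsilon>"
proof -
  obtain L where "L > 0" and L: "\<And>r. \<exists>\<tau>. r < \<tau> \<and> \<tau> < r + L \<and> (\<forall>x. dist x (\<phi> \<tau> x) \<le> \<epsilon> / 3)"
    by (rule near_return_time[of "\<epsilon> / 3"]) (use assms in auto)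
  obtain \<delta> where d: "\<delta> > 0" "\<And>s x y. s \<in> {0..L} \<Longrightarrow> dist x y < \<delta> \<Longrightarrow> dist (\<phi> s x) (\<phi> s y) < \<epsilon> / 3"
  proof (rule uniformly_continuous_flow[of "\<epsilon> / 3" 0 L])
    show "\<epsilon> / 3 > 0" using assms by simp
  qed simp
  have "dist (\<phi> s x) (\<phi> s y) < \<epsilon>" if "dist x y < \<delta>" for s x y
  proof -
    obtain \<tau> where t: "- s < \<tau>" "\<tau> < - s + L" "\<And>x. dist x (\<phi> \<tau> x) \<le> \<epsilon> / 3" using L by blast
    have "dist (\<phi> (\<tau> + s) x) (\<phi> (\<tau> + s) y) < \<epsilon> / 3" using t that by (intro d(2)) auto
    moreover have "dist (\<phi> s x) (\<phi> (\<tau> + s) x) \<le> \<epsilon> / 3" "dist (\<phi> s y) (\<phi> (\<tau> + s) y) \<le> \<epsilon> / 3"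
      using t(3) by (simp_all add: flow_add)
    ultimately show ?thesis
      using dist_triangle[of "\<phi> s x" "\<phi> s y" "\<phi> (\<tau> + s) x"]
        dist_triangle[of "\<phi> (\<tau> + s) x" "\<phi> s y" "\<phi> (\<tau> + s) y"]
        dist_commute[of "\<phi> s y" "\<phi> (\<tau> + s) y"] by linarith
  qed
  then show ?thesis using d(1) that by blast
qed

section \<open>Displacement as a measure of the size of a time\<close>

lemma dist_le_displacement: "dist x (\<phi> \<tau> x) \<le> displacement \<phi> \<tau>"
proof -
  have "bounded (UNIV :: 'a set)" using compact_space by (rule compact_imp_bounded)
  then have "bdd_above (range (\<lambda>x. dist x (\<phi> \<tau> x)))"
    by (auto simp: bdd_above_def intro!: exI[of _ "diameter (UNIV :: 'a set)"] diameter_bounded_bound)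
  then show ?thesis unfolding displacement_def by (rule cSUP_upper[OF UNIV_I])
qed

lemma displacement_le: "(\<And>x. dist x (\<phi> \<tau> x) \<le> \<epsilon>) \<Longrightarrow> displacement \<phi> \<tau> \<le> \<epsilon>"
  unfolding displacement_def by (rule cSUP_least) auto

lemma dist_le_displacement_diff: "dist (\<phi> s x) (\<phi> t x) \<le> displacement \<phi> (t - s)"
  using dist_le_displacement[of "\<phi> s x" "t - s"] by (simp add: flow_diff)

lemma displacement_0: "displacement \<phi> 0 = 0"
  by (simp add: displacement_def flow_0)

lemma displacement_nonneg: "displacement \<phi> t \<ge> 0"
  using dist_le_displacement[of undefined t] zero_le_dist order_trans by blast

lemma displacement_minus: "displacement \<phi> (- t) = displacement \<phi> t"
proof -
  have le: "displacement \<phi> (- t) \<le> displacement \<phi> t" for t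
  proof (rule displacement_le)
    fix x
    show "dist x (\<phi> (- t) x) \<le> displacement \<phi> t"
      using dist_le_displacement_diff[of "- t" x 0] by (simp add: dist_commute flow_0)
  qed
  show ?thesis using le[of t] le[of "- t"] by simp
qed

lemma displacement_add: "displacement \<phi> (s + t) \<le> displacement \<phi> s + displacement \<phi> t"
proof (rule displacement_le)
  fix x
  have "dist x (\<phi> (s + t) x) \<le> dist x (\<phi> t x) + dist (\<phi> t x) (\<phi> s (\<phi> t x))"
    by (simp add: flow_add dist_triangle)
  also have "\<dots> \<le> displacement \<phi> t + displacement \<phi> s"
    by (intro add_mono dist_le_displacement)
  finally show "dist x (\<phi> (s + t) x) \<le> displacement \<phi> s + displacement \<phi> t" by simp
qed

lemma displacement_continuous_at_0:
  assumes "\<epsilon> > 0"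
  shows "\<exists>\<delta>>0. \<forall>t. \<bar>t\<bar> < \<delta> \<longrightarrow> displacement \<phi> t < \<epsilon>"
proof -
  obtain \<delta> where d: "\<delta> > 0" "\<And>s t x. s \<in> {-1..1} \<Longrightarrow> t \<in> {-1..1} \<Longrightarrow> \<bar>s - t\<bar> < \<delta> \<Longrightarrow> dist (\<phi> s x) (\<phi> t x) < \<epsilon> / 2"
  proof (rule uniformly_continuous_flow[of "\<epsilon> / 2" "-1" 1])
    show "\<epsilon> / 2 > 0" using assms by simp
  qed simp
  have "displacement \<phi> t < \<epsilon>" if "\<bar>t\<bar> < min \<delta> 1" for t
  proof -
    have "displacement \<phi> t \<le> \<epsilon> / 2"
      using d(2)[of 0 t] that by (intro displacement_le less_imp_le) (auto simp: abs_less_iff flow_0)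
    then show ?thesis using assms by linarith
  qed
  then show ?thesis using d(1) by (intro exI[of _ "min \<delta> 1"]) auto
qed

lemma relatively_dense_displacement:
  "\<epsilon> > 0 \<Longrightarrow> relatively_dense {\<tau>. displacement \<phi> \<tau> \<le> \<epsilon>}"
  by (rule relatively_dense_mono[OF near_return_times]) (auto intro: displacement_le)

text \<open>Closeness of two points of one orbit persists under the flow by equicontinuity. Hence
  every point of that orbit, and by density every point of the space, is moved little in time
  \<open>t - s\<close>.\<close>

lemma displacement_small:
  assumes "\<epsilon> > 0"
  obtains \<delta> where "\<delta> > 0" "\<And>s t x. dist (\<phi> s x) (\<phi> t x) < \<delta> \<Longrightarrow> displacement \<phi> (t - s) < \<epsilon>"
proof -
  obtain \<delta> where d: "\<delta> > 0" "\<And>s x y. dist x y < \<delta> \<Longrightarrow> dist (\<phi> s x) (\<phi> s y) < \<epsilon> / 2"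
    by (rule equicontinuous_flow[of "\<epsilon> / 2"]) (use assms in auto)
  have "displacement \<phi> (t - s) < \<epsilon>" if less: "dist (\<phi> s x) (\<phi> t x) < \<delta>" for s t x
  proof -
    have "y \<in> {y. dist y (\<phi> (t - s) y) \<le> \<epsilon> / 2}" for y
    proof (rule closed_contains_orbit[of _ x])
      show "closed {y. dist y (\<phi> (t - s) y) \<le> \<epsilon> / 2}"
        by (intro closed_Collect_le flow_continuous_compose continuous_intros)
      show "\<phi> r x \<in> {y. dist y (\<phi> (t - s) y) \<le> \<epsilon> / 2}" for r
        using d(2)[OF less, of "r - s"] by (simp flip: flow_add add: less_imp_le algebra_simps)
    qed
    then have "displacement \<phi> (t - s) \<le> \<epsilon> / 2" by (intro displacement_le) auto
    then show ?thesis using assms by linarith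
  qed
  then show ?thesis using d(1) that by blast
qed

text \<open>Along a convergent sequence of orbit points the time differences have small
  displacement, so a character yields Cauchy phases. Conversely, a failure of continuity at 0
  supplies times with displacement tending to 0 and phases bounded away from 1.\<close>

lemma exponent_group_orbit: "exponent_group (orbit_map \<phi> x) = characters \<phi>"
proof (intro set_eqI iffI)
  fix \<alpha>
  assume a: "\<alpha> \<in> characters \<phi>"
  show "\<alpha> \<in> exponent_group (orbit_map \<phi> x)"
    unfolding exponent_group_def orbit_map_def mem_Collect_eq convergent_circle_proj_iff
  proof (intro allI impI)
    fix t :: "nat \<Rightarrow> real"
    assume "convergent (\<lambda>i. \<phi> (t i) x)"
    then have c: "Cauchy (\<lambda>i. \<phi> (t i) x)" by (rule convergent_Cauchy)
    have "Cauchy (\<lambda>i. ei (\<alpha> * t i))"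
    proof (rule metric_CauchyI)
      fix \<epsilon> :: real assume "\<epsilon> > 0"
      then obtain \<delta> where d: "\<delta> > 0" "\<And>\<tau>. displacement \<phi> \<tau> < \<delta> \<Longrightarrow> norm (ei (\<alpha> * \<tau>) - 1) < \<epsilon>"
        using a by (auto simp: characters_def)
      obtain \<delta>' where d': "\<delta>' > 0" "\<And>s t y. dist (\<phi> s y) (\<phi> t y) < \<delta>' \<Longrightarrow> displacement \<phi> (t - s) < \<delta>"
        using displacement_small[OF d(1)] by blast
      obtain N where N: "\<And>i j. i \<ge> N \<Longrightarrow> j \<ge> N \<Longrightarrow> dist (\<phi> (t i) x) (\<phi> (t j) x) < \<delta>'"
        using metric_CauchyD[OF c d'(1)] by blast
      have "dist (ei (\<alpha> * t i)) (ei (\<alpha> * t j)) < \<epsilon>" if "i \<ge> N" "j \<ge> N" for i j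
        using d(2)[OF d'(2)[OF N[OF that(2,1)]]] by (simp add: dist_norm norm_ei_diff right_diff_distrib)
      then show "\<exists>N. \<forall>i\<ge>N. \<forall>j\<ge>N. dist (ei (\<alpha> * t i)) (ei (\<alpha> * t j)) < \<epsilon>" by blast
    qed
    then show "convergent (\<lambda>i. ei (\<alpha> * t i))" by (rule Cauchy_convergent)
  qed
next
  fix \<alpha>
  assume a: "\<alpha> \<in> exponent_group (orbit_map \<phi> x)"
  show "\<alpha> \<in> characters \<phi>"
  proof (rule ccontr)
    assume "\<alpha> \<notin> characters \<phi>"
    then obtain \<epsilon> where "\<epsilon> > 0" and e: "\<And>\<delta>. \<delta> > 0 \<Longrightarrow> \<exists>\<tau>. displacement \<phi> \<tau> < \<delta> \<and> \<not> norm (ei (\<alpha> * \<tau>) - 1) < \<epsilon>"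
      by (auto simp: characters_def)
    have "\<forall>n. \<exists>\<tau>. displacement \<phi> \<tau> < 1 / real (Suc n) \<and> \<not> norm (ei (\<alpha> * \<tau>) - 1) < \<epsilon>"
      using e by simp
    then obtain \<tau> where t: "\<And>n. displacement \<phi> (\<tau> n) < 1 / real (Suc n)" "\<And>n. \<not> norm (ei (\<alpha> * \<tau> n) - 1) < \<epsilon>"
      by metis
    \<comment> \<open>Interleaving with time 0 keeps the orbit points convergent to \<open>x\<close>
      and sets each bad phase against the phase 1.\<close>
    define s where "s i = (if even i then 0 else \<tau> i)" for i
    have "(\<lambda>i. \<phi> (s i) x) \<longlonglongrightarrow> x"
    proof (rule metric_LIMSEQ_I)
      fix e :: real assume "e > 0"
      then obtain N :: nat where N: "1 / real (Suc N) < e" using nat_approx_posE by blast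
      have "dist (\<phi> (s i) x) x < e" if "i \<ge> N" for i
      proof (cases "even i")
        case True
        then show ?thesis using \<open>e > 0\<close> by (simp add: s_def flow_0)
      next
        case False
        have "dist (\<phi> (\<tau> i) x) x \<le> displacement \<phi> (\<tau> i)"
          using dist_le_displacement by (simp add: dist_commute)
        also have "\<dots> < 1 / real (Suc i)" by (rule t)
        also have "\<dots> \<le> 1 / real (Suc N)" using that by (intro divide_left_mono) auto
        finally show ?thesis using N False by (simp add: s_def)
      qed
      then show "\<exists>N. \<forall>i\<ge>N. dist (\<phi> (s i) x) x < e" by blast
    qed
    then have "convergent (\<lambda>i. orbit_map \<phi> x (s i))" by (auto simp: convergent_def orbit_map_def)
    then have "convergent (\<lambda>i. circle_proj (\<alpha> * s i))" using a by (auto simp: exponent_group_def)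
    then have "Cauchy (\<lambda>i. ei (\<alpha> * s i))"
      unfolding convergent_circle_proj_iff by (rule convergent_Cauchy)
    then obtain N where N: "\<And>i j. i \<ge> N \<Longrightarrow> j \<ge> N \<Longrightarrow> dist (ei (\<alpha> * s i)) (ei (\<alpha> * s j)) < \<epsilon>"
      using metric_CauchyD[OF _ \<open>\<epsilon> > 0\<close>] by blast
    show False
      using N[of "Suc (2 * N)" "2 * N"] t(2)[of "Suc (2 * N)"] by (simp add: s_def dist_norm)
  qed
qed

section \<open>The exponent group of a flow and its control of the displacement\<close>

lemma flow_exponent_group_eq: "flow_exponent_group \<phi> = characters \<phi>"
  unfolding flow_exponent_group_def by (rule the_equality) (auto simp: exponent_group_orbit)

lemma characters_uminus: "\<alpha> \<in> characters \<phi> \<Longrightarrow> - \<alpha> \<in> characters \<phi>"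
  by (simp add: characters_def norm_ei_minus)

lemma zero_in_characters: "0 \<in> characters \<phi>"
  by (auto simp: characters_def intro: exI[of _ 1])

lemma displacement_controlled_by_characters:
  assumes "\<epsilon> > 0"
  shows "\<exists>\<Lambda>. finite \<Lambda> \<and> \<Lambda> \<subseteq> characters \<phi> \<and>
    (\<forall>t. (\<forall>\<nu>\<in>\<Lambda>. Re (ei (\<nu> * t)) \<ge> 1/2) \<longrightarrow> displacement \<phi> t \<le> \<epsilon>)"
proof -
  obtain \<Lambda> where L: "finite \<Lambda>" "\<And>\<nu>. \<nu> \<in> \<Lambda> \<Longrightarrow> \<exists>C. \<forall>\<tau>. norm (ei (\<nu> * \<tau>) - 1) \<le> C * displacement \<phi> \<tau>"
    "\<And>t. (\<forall>\<nu>\<in>\<Lambda>. Re (ei (\<nu> * t)) \<ge> 1/2) \<Longrightarrow> displacement \<phi> t \<le> \<epsilon>"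
    using bohr_neighbourhood[of "displacement \<phi>", OF displacement_0 displacement_minus displacement_add
      displacement_continuous_at_0 relatively_dense_displacement assms] by blast
  have "\<nu> \<in> characters \<phi>" if "\<nu> \<in> \<Lambda>" for \<nu>
    unfolding characters_def mem_Collect_eq
  proof (intro allI impI)
    fix e :: real assume "e > 0"
    obtain C where C: "\<And>\<tau>. norm (ei (\<nu> * \<tau>) - 1) \<le> C * displacement \<phi> \<tau>"
      using L(2)[OF \<open>\<nu> \<in> \<Lambda>\<close>] by blast
    show "\<exists>\<delta>>0. \<forall>\<tau>. displacement \<phi> \<tau> < \<delta> \<longrightarrow> norm (ei (\<nu> * \<tau>) - 1) < e"
    \<comment> \<open>\<open>C\<close> may be nonpositive, whereas \<open>\<bar>C\<bar> + 1\<close>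
      is a positive constant that still dominates it.\<close>
    proof (intro exI[of _ "e / (\<bar>C\<bar> + 1)"] conjI allI impI)
      show "e / (\<bar>C\<bar> + 1) > 0" using \<open>e > 0\<close> by simp
      fix \<tau> assume "displacement \<phi> \<tau> < e / (\<bar>C\<bar> + 1)"
      then have "(\<bar>C\<bar> + 1) * displacement \<phi> \<tau> < e" by (simp add: field_simps)
      moreover have "C * displacement \<phi> \<tau> \<le> (\<bar>C\<bar> + 1) * displacement \<phi> \<tau>"
        using displacement_nonneg by (intro mult_right_mono) auto
      ultimately show "norm (ei (\<nu> * \<tau>) - 1) < e" using C[of \<tau>] by linarith
    qed
  qed
  then show ?thesis using L(1,3) by blast
qed

end


section \<open>Phases along orbits and topological equivalence\<close>

lemma bounded_multiples_imp_zero: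
  fixes c C :: real
  assumes "\<And>t. \<bar>c * t\<bar> \<le> C"
  shows "c = 0"
proof (rule ccontr)
  assume "c \<noteq> 0"
  then have "\<bar>C + 1\<bar> \<le> C" using assms[of "(C + 1) / c"] by simp
  then show False by linarith
qed

text \<open>Evaluating \<open>F\<close> at a product through either factor shows that the intervals
  from \<open>(F n - C) / n\<close> to \<open>(F n + C) / n\<close>, for positive \<open>n\<close>,
  meet pairwise. The supremum of their lower ends lies in all of them.\<close>

lemma quasi_additive_nat:
  fixes F :: "nat \<Rightarrow> real"
  assumes qa: "\<And>m n. \<bar>F (m + n) - F m - F n\<bar> \<le> C"
  obtains \<mu> :: real where "\<And>n. \<bar>F n - \<mu> * n\<bar> \<le> C"
proof -
  have C: "C \<ge> 0" using qa[of 0 0] by linarith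
  have mult: "\<bar>F (Suc k * n) - Suc k * F n\<bar> \<le> k * C" for k n
  proof (induction k)
    case 0
    then show ?case by simp
  next
    case (Suc k)
    have "\<bar>F (Suc (Suc k) * n) - F (Suc k * n) - F n\<bar> \<le> C"
      using qa[of "Suc k * n" n] by (simp add: algebra_simps)
    with Suc show ?case by (simp add: algebra_simps)
  qed
  have key: "(F (Suc n) - C) / Suc n \<le> (F (Suc m) + C) / Suc m" for m n
  proof -
    have "Suc m * (F (Suc n) - C) \<le> F (Suc m * Suc n)"
      using mult[of m "Suc n"] C by (simp add: algebra_simps)
    also have "\<dots> \<le> Suc n * (F (Suc m) + C)"
      using mult[of n "Suc m"] C by (simp add: algebra_simps)
    finally show ?thesis
      by (simp add: divide_simps mult.commute del: of_nat_Suc)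
  qed
  define \<mu> where "\<mu> = (SUP n. (F (Suc n) - C) / Suc n)"
  have bdd: "bdd_above (range (\<lambda>n. (F (Suc n) - C) / Suc n))"
    using key[of _ 0] by (intro bdd_aboveI2[of _ _ "(F (Suc 0) + C) / Suc 0"]) auto
  have "\<bar>F n - \<mu> * n\<bar> \<le> C" for n
  proof (cases n)
    case 0
    then show ?thesis using qa[of 0 0] by simp
  next
    case (Suc m)
    have "(F (Suc m) - C) / Suc m \<le> \<mu>"
      unfolding \<mu>_def using bdd by (intro cSUP_upper) auto
    moreover have "\<mu> \<le> (F (Suc m) + C) / Suc m"
      unfolding \<mu>_def using key by (intro cSUP_least) auto
    ultimately show ?thesis
      by (simp add: Suc divide_simps abs_le_iff algebra_simps del: of_nat_Suc)
  qed
  then show ?thesis using that by blast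
qed

text \<open>The integer part of a time is handled by the discrete case, the fractional part by
  compactness, and negative times by the bound on \<open>F t + F (- t)\<close>.\<close>

lemma quasi_additive_real:
  fixes F :: "real \<Rightarrow> real"
  assumes qa: "\<And>s t. \<bar>F (s + t) - F s - F t\<bar> \<le> C" and cont: "continuous_on UNIV F"
  obtains \<mu> C' :: real where "\<And>t. \<bar>F t - \<mu> * t\<bar> \<le> C'"
proof -
  obtain \<mu> where mu: "\<And>n::nat. \<bar>F n - \<mu> * n\<bar> \<le> C"
    using quasi_additive_nat[of "\<lambda>n. F (real n)" C] qa by auto
  have "compact (F ` {0..1})"
    by (intro compact_continuous_image continuous_on_subset[OF cont] compact_Icc) auto
  then obtain K where K: "\<And>t. 0 \<le> t \<Longrightarrow> t \<le> 1 \<Longrightarrow> \<bar>F t\<bar> \<le> K"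
    using compact_imp_bounded bounded_iff by (metis atLeastAtMost_iff image_eqI real_norm_def)
  define C1 where "C1 = 2 * C + K + \<bar>\<mu>\<bar>"
  have nonneg: "\<bar>F t - \<mu> * t\<bar> \<le> C1" if "t \<ge> 0" for t
  proof -
    define n where "n = nat \<lfloor>t\<rfloor>"
    define f where "f = t - n"
    have "real n = of_int \<lfloor>t\<rfloor>" using that by (simp add: n_def)
    then have f: "0 \<le> f" "f \<le> 1" unfolding f_def by linarith+
    have "\<bar>\<mu> * f\<bar> \<le> \<bar>\<mu>\<bar>" using f mult_left_le[of f "\<bar>\<mu>\<bar>"] by (simp add: abs_mult)
    moreover have "F t - \<mu> * t = (F (n + f) - F n - F f) + (F n - \<mu> * n) + F f - \<mu> * f"
      by (simp add: f_def algebra_simps)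
    ultimately show ?thesis
      using qa[of n f] mu[of n] K[OF f] unfolding C1_def by linarith
  qed
  have "\<bar>F t - \<mu> * t\<bar> \<le> C1 + 2 * C" for t
  proof (cases "t \<ge> 0")
    case True
    then show ?thesis using nonneg[of t] qa[of 0 0] by linarith
  next
    case False
    have "\<bar>F 0 - F t - F (- t)\<bar> \<le> C" "\<bar>F 0\<bar> \<le> C" using qa[of t "- t"] qa[of 0 0] by auto
    moreover have "\<bar>F (- t) + \<mu> * t\<bar> \<le> C1" using nonneg[of "- t"] False by simp
    ultimately show ?thesis by linarith
  qed
  then show ?thesis using that by blast
qed

text \<open>Bohr's theorem on the argument of an almost periodic function: over a near-period the phase
  \<open>\<theta>\<close> changes by almost an integer, the same one at all times, which makes \<open>\<theta>\<close> quasi-additive;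
  iterating a near-period shows that its slope times the near-period is close to that integer.\<close>

lemma almost_periodic_phase_asymptotically_linear:
  fixes \<phi> :: "real \<Rightarrow> 'a::complete_space \<Rightarrow> 'a" and \<theta> :: "real \<Rightarrow> real"
  assumes map: "minimal_almost_periodic_flow \<phi>"
    and cont: "continuous_on UNIV \<theta>"
    and ap: "\<And>\<epsilon>. \<epsilon> > 0 \<Longrightarrow> \<exists>\<delta>>0. \<forall>\<tau>. displacement \<phi> \<tau> < \<delta> \<longrightarrow> (\<forall>t. norm (ei (\<theta> (t + \<tau>) - \<theta> t) - 1) < \<epsilon>)"
  obtains \<mu> C where "\<mu> \<in> characters \<phi>" "\<And>t. \<bar>\<theta> t - \<mu> * t\<bar> \<le> C"
proof -
  have step: "\<exists>\<delta>>0. \<forall>\<tau>. displacement \<phi> \<tau> < \<delta> \<longrightarrow> (\<exists>n::int. \<forall>t. \<bar>\<theta> (t + \<tau>) - \<theta> t - n\<bar> < \<epsilon>)"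
    if e: "0 < \<epsilon>" "\<epsilon> \<le> 1/4" for \<epsilon>
  proof -
    obtain \<eta> where eta: "\<eta> > 0" "\<And>x. norm (ei x - 1) < \<eta> \<Longrightarrow> \<bar>x - of_int (round x)\<bar> < \<epsilon>"
      using ei_near_1_imp_near_int[OF e(1)] by blast
    obtain \<delta> where d: "\<delta> > 0" "\<And>\<tau> t. displacement \<phi> \<tau> < \<delta> \<Longrightarrow> norm (ei (\<theta> (t + \<tau>) - \<theta> t) - 1) < \<eta>"
      using ap[OF eta(1)] by blast
    have "\<exists>n::int. \<forall>t. \<bar>\<theta> (t + \<tau>) - \<theta> t - n\<bar> < \<epsilon>" if "displacement \<phi> \<tau> < \<delta>" for \<tau>
    proof -
      define g where "g t = \<theta> (t + \<tau>) - \<theta> t" for t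
      have near: "\<bar>g t - of_int (round (g t))\<bar> < \<epsilon>" for t
        unfolding g_def by (intro eta(2) d(2) that)
      have gc: "continuous_on UNIV g"
        unfolding g_def by (intro continuous_intros continuous_on_compose2[OF cont]) auto
      define n where "n = round (g 0)"
      define S where "S = {t. \<bar>g t - n\<bar> < \<epsilon>}"
      \<comment> \<open>No value of \<open>g\<close> has distance from \<open>n\<close> in
        [\<epsilon>, 1/2], so the set is both open and closed and the nearest integer is the same at
        all times.\<close>
      have S: "S = {t. \<bar>g t - n\<bar> \<le> 1/2}"
        unfolding S_def
      proof (rule Collect_cong, rule iffI)
        fix t assume "\<bar>g t - n\<bar> \<le> 1/2"
        then have "\<bar>real_of_int (round (g t)) - real_of_int n\<bar> < 1"
          using near[of t] e by linarith
        then have "round (g t) = n" by linarith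
        then show "\<bar>g t - n\<bar> < \<epsilon>" using near[of t] by simp
      next
        fix t assume "\<bar>g t - n\<bar> < \<epsilon>"
        then show "\<bar>g t - n\<bar> \<le> 1/2" using e by linarith
      qed
      have "open S"
        unfolding S_def by (intro open_Collect_less continuous_intros gc)
      moreover have "closed S"
        unfolding S by (intro closed_Collect_le continuous_intros gc)
      ultimately have "S = {} \<or> S = UNIV" using clopen by blast
      moreover have "0 \<in> S" using near[of 0] by (simp add: S_def n_def)
      ultimately have "S = UNIV" by blast
      then have "\<bar>g t - n\<bar> < \<epsilon>" for t by (auto simp: S_def)
      then show ?thesis unfolding g_def by blast
    qed
    then show ?thesis using d(1) by blast
  qed
  obtain \<delta> where \<delta>: "\<delta> > 0" "\<And>\<tau>. displacement \<phi> \<tau> < \<delta> \<Longrightarrow> \<exists>n::int. \<forall>t. \<bar>\<theta> (t + \<tau>) - \<theta> t - n\<bar> < 1/4"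
    using step[of "1/4"] by auto
  obtain L where "L > 0" and L: "\<And>r. \<exists>\<tau>. r < \<tau> \<and> \<tau> < r + L \<and> displacement \<phi> \<tau> \<le> \<delta> / 2"
    using relatively_dense_displacement[OF map, of "\<delta> / 2"] \<delta>(1)
    unfolding relatively_dense_def by fastforce
  have shift: "\<exists>\<tau> n. r < \<tau> \<and> \<tau> < r + L \<and> (\<forall>t. \<bar>\<theta> (t + \<tau>) - \<theta> t - of_int n\<bar> < 1/4)" for r
  proof -
    obtain \<tau> where t: "r < \<tau>" "\<tau> < r + L" "displacement \<phi> \<tau> \<le> \<delta> / 2" using L by blast
    then have "displacement \<phi> \<tau> < \<delta>" using \<delta>(1) by linarith
    then show ?thesis using \<delta>(2) t by blast
  qed
  have "compact (\<theta> ` {0..2 * L})"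
    by (intro compact_continuous_image continuous_on_subset[OF cont] compact_Icc) auto
  then obtain K where K: "\<And>t. 0 \<le> t \<Longrightarrow> t \<le> 2 * L \<Longrightarrow> \<bar>\<theta> t\<bar> \<le> K"
    using compact_imp_bounded bounded_iff by (metis atLeastAtMost_iff image_eqI real_norm_def)
  \<comment> \<open>A near-period moves both times into \<open>{0..2 * L}\<close>, where \<theta> is
    bounded by \<open>K\<close>, and alters the increment by less than 1/2.\<close>
  have local: "\<bar>\<theta> (t + s) - \<theta> t\<bar> \<le> 2 * K + 1/2" if "0 \<le> s" "s \<le> L" for s t
  proof -
    obtain \<tau> n where t: "- t < \<tau>" "\<tau> < - t + L" "\<And>t. \<bar>\<theta> (t + \<tau>) - \<theta> t - of_int n\<bar> < 1/4"
      using shift by blast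
    have "\<bar>\<theta> (t + \<tau>)\<bar> \<le> K" "\<bar>\<theta> (t + s + \<tau>)\<bar> \<le> K" using t that by (auto intro!: K)
    then show ?thesis using t(3)[of t] t(3)[of "t + s"] by linarith
  qed
  \<comment> \<open>With a near-period \<tau> less than \<open>L\<close> below \<open>r\<close> in
    place of \<open>r\<close>, the same integer appears at time \<open>s\<close> and at time 0 and
    cancels; \<open>local\<close> pays for the two replacements.\<close>
  have "\<bar>(\<theta> (s + r) - \<theta> 0) - (\<theta> s - \<theta> 0) - (\<theta> r - \<theta> 0)\<bar> \<le> 4 * K + 3/2" for s r
  proof -
    obtain \<tau> n where t: "r - L < \<tau>" "\<tau> < r - L + L" "\<And>t. \<bar>\<theta> (t + \<tau>) - \<theta> t - of_int n\<bar> < 1/4"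
      using shift by blast
    have "\<bar>\<theta> (t + r) - \<theta> (t + \<tau>)\<bar> \<le> 2 * K + 1/2" for t
      using local[of "r - \<tau>" "t + \<tau>"] t by simp
    from this[of s] this[of 0] show ?thesis using t(3)[of s] t(3)[of 0] unfolding add_0_left by linarith
  qed
  moreover have "continuous_on UNIV (\<lambda>t. \<theta> t - \<theta> 0)" by (intro continuous_intros cont)
  ultimately obtain \<mu> C where mu: "\<And>t. \<bar>(\<theta> t - \<theta> 0) - \<mu> * t\<bar> \<le> C"
    using quasi_additive_real[of "\<lambda>t. \<theta> t - \<theta> 0"] by blast
  have "\<mu> \<in> characters \<phi>"
    unfolding characters_def mem_Collect_eq
  proof (intro allI impI)
    fix \<epsilon> :: real assume "\<epsilon> > 0"
    obtain \<eta> where eta: "\<eta> > 0" "\<And>x. \<bar>x\<bar> < \<eta> \<Longrightarrow> norm (ei x - 1) < \<epsilon>"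
      using ei_near_1[OF \<open>\<epsilon> > 0\<close>] by blast
    define \<epsilon>' where "\<epsilon>' = min (1/4) (\<eta> / 2)"
    have e': "0 < \<epsilon>'" "\<epsilon>' \<le> 1/4" "\<epsilon>' < \<eta>" using eta(1) by (auto simp: \<epsilon>'_def)
    obtain \<delta> where d: "\<delta> > 0" "\<And>\<tau>. displacement \<phi> \<tau> < \<delta> \<Longrightarrow> \<exists>n::int. \<forall>t. \<bar>\<theta> (t + \<tau>) - \<theta> t - n\<bar> < \<epsilon>'"
      using step[OF e'(1,2)] by blast
    have "norm (ei (\<mu> * \<tau>) - 1) < \<epsilon>" if small: "displacement \<phi> \<tau> < \<delta>" for \<tau>
    proof -
      obtain n :: int where n: "\<And>t. \<bar>\<theta> (t + \<tau>) - \<theta> t - n\<bar> < \<epsilon>'" using d(2)[OF small] by blast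
      have iter: "\<bar>\<theta> (real m * \<tau>) - \<theta> 0 - real m * n\<bar> \<le> real m * \<epsilon>'" for m
      proof (induction m)
        case 0
        then show ?case by simp
      next
        case (Suc m)
        then show ?case using n[of "real m * \<tau>"] by (simp add: algebra_simps)
      qed
      have "\<bar>\<mu> * \<tau> - n\<bar> \<le> \<epsilon>'"
      proof (rule ccontr)
        assume "\<not> ?thesis"
        \<comment> \<open>Otherwise the discrepancy, accumulated over \<open>m\<close> steps, would
          exceed the bound \<open>C\<close> on the deviation from linearity.\<close>
        then obtain m :: nat where m: "C < real m * (\<bar>\<mu> * \<tau> - n\<bar> - \<epsilon>')"
          using reals_Archimedean3[of "\<bar>\<mu> * \<tau> - n\<bar> - \<epsilon>'"] by auto
        have "real m * \<bar>\<mu> * \<tau> - n\<bar> = \<bar>real m * (\<mu> * \<tau> - n)\<bar>"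
          by (simp add: abs_mult)
        also have "\<dots> = \<bar>\<mu> * (real m * \<tau>) - real m * n\<bar>"
          by (simp add: algebra_simps)
        also have "\<dots> \<le> C + real m * \<epsilon>'"
          using mu[of "real m * \<tau>"] iter[of m] by linarith
        finally show False using m by (simp add: algebra_simps)
      qed
      then have "norm (ei (\<mu> * \<tau> - n) - 1) < \<epsilon>" using e'(3) by (intro eta(2)) linarith
      moreover have "ei (of_int n) = 1" by (simp add: ei_eq_1_iff)
      ultimately show ?thesis by (simp add: ei_diff)
    qed
    then show "\<exists>\<delta>>0. \<forall>\<tau>. displacement \<phi> \<tau> < \<delta> \<longrightarrow> norm (ei (\<mu> * \<tau>) - 1) < \<epsilon>" using d(1) by blast
  qed
  moreover have "\<bar>\<theta> t - \<mu> * t\<bar> \<le> C + \<bar>\<theta> 0\<bar>" for t using mu[of t] by linarith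
  ultimately show ?thesis using that by blast
qed

text \<open>A small displacement under \<phi> gives close images, since \<open>h\<close> is
  uniformly continuous on a compact space. So the increment of \<sigma> has small displacement under
  \<psi>, and the phase \<open>\<nu> * \<sigma> t\<close> changes by nearly an integer.\<close>

lemma characters_pullback:
  fixes \<phi> :: "real \<Rightarrow> 'a::complete_space \<Rightarrow> 'a" and \<psi> :: "real \<Rightarrow> 'b::complete_space \<Rightarrow> 'b"
  assumes map: "minimal_almost_periodic_flow \<phi>" "minimal_almost_periodic_flow \<psi>"
    and h: "continuous_on UNIV h" and \<sigma>: "continuous_on UNIV \<sigma>"
    and eq: "\<And>t. h (\<phi> t x) = \<psi> (\<sigma> t) (h x)" and \<nu>: "\<nu> \<in> characters \<psi>"
  obtains \<mu> C where "\<mu> \<in> characters \<phi>" "\<And>t. \<bar>\<nu> * \<sigma> t - \<mu> * t\<bar> \<le> C"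
proof (rule almost_periodic_phase_asymptotically_linear[OF map(1)])
  show "continuous_on UNIV (\<lambda>t. \<nu> * \<sigma> t)" by (intro continuous_intros \<sigma>)
  fix \<epsilon> :: real assume "\<epsilon> > 0"
  have "\<forall>\<epsilon>>0. \<exists>\<delta>>0. \<forall>\<tau>. displacement \<psi> \<tau> < \<delta> \<longrightarrow> norm (ei (\<nu> * \<tau>) - 1) < \<epsilon>"
    using \<nu> by (simp only: characters_def mem_Collect_eq)
  from this[rule_format, OF \<open>\<epsilon> > 0\<close>] obtain \<delta>1 where d1: "\<delta>1 > 0"
    "\<And>\<tau>. displacement \<psi> \<tau> < \<delta>1 \<Longrightarrow> norm (ei (\<nu> * \<tau>) - 1) < \<epsilon>"
    by blast
  obtain \<delta>2 where d2: "\<delta>2 > 0" "\<And>s t y. dist (\<psi> s y) (\<psi> t y) < \<delta>2 \<Longrightarrow> displacement \<psi> (t - s) < \<delta>1"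
    using displacement_small[OF map(2) d1(1)] by blast
  have "uniformly_continuous_on UNIV h"
    using h compact_space[OF map(1)] by (rule compact_uniformly_continuous)
  from uniformly_continuous_onE[OF this d2(1)] obtain \<delta>3
    where d3: "\<delta>3 > 0" "\<And>y z. y \<in> UNIV \<Longrightarrow> z \<in> UNIV \<Longrightarrow> dist z y < \<delta>3 \<Longrightarrow> dist (h z) (h y) < \<delta>2"
    by blast
  have "norm (ei (\<nu> * \<sigma> (t + \<tau>) - \<nu> * \<sigma> t) - 1) < \<epsilon>" if "displacement \<phi> \<tau> < \<delta>3" for \<tau> t
  proof -
    have "dist (\<phi> t x) (\<phi> (t + \<tau>) x) < \<delta>3"
      using dist_le_displacement_diff[OF map(1), of t x "t + \<tau>"] that by simp
    then have "displacement \<psi> (\<sigma> (t + \<tau>) - \<sigma> t) < \<delta>1"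
      by (intro d2(2)[of _ "h x"]) (simp add: d3(2) flip: eq)
    from d1(2)[OF this] show ?thesis by (simp only: right_diff_distrib)
  qed
  then show "\<exists>\<delta>>0. \<forall>\<tau>. displacement \<phi> \<tau> < \<delta> \<longrightarrow> (\<forall>t. norm (ei (\<nu> * \<sigma> (t + \<tau>) - \<nu> * \<sigma> t) - 1) < \<epsilon>)"
    using d3(1) by blast
qed (rule that)

section \<open>One-point spaces and trivial exponents\<close>

lemma fixed_point_imp_singleton:
  fixes \<phi> :: "real \<Rightarrow> 'a::complete_space \<Rightarrow> 'a" and x y :: 'a
  assumes map: "minimal_almost_periodic_flow \<phi>" and fixed: "\<And>t. \<phi> t p = p"
  shows "x = y"
proof -
  have "z = p" for z
    using closed_contains_orbit[OF map, of "{p}" p z] fixed by simp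
  from this[of x] this[of y] show ?thesis by simp
qed

text \<open>Without nonzero frequencies every time satisfies the Bohr condition, so the displacement
  vanishes identically and every point is fixed.\<close>

lemma characters_trivial_imp_singleton:
  fixes \<phi> :: "real \<Rightarrow> 'a::complete_space \<Rightarrow> 'a" and x y :: 'a
  assumes map: "minimal_almost_periodic_flow \<phi>" and triv: "characters \<phi> \<subseteq> {0}"
  shows "x = y"
proof (rule fixed_point_imp_singleton[OF map])
  fix t
  have "dist x (\<phi> t x) \<le> \<epsilon>" if eps: "\<epsilon> > 0" for \<epsilon>
  proof -
    obtain \<Lambda> where L: "\<Lambda> \<subseteq> characters \<phi>"
      "\<forall>t. (\<forall>\<nu>\<in>\<Lambda>. Re (ei (\<nu> * t)) \<ge> 1/2) \<longrightarrow> displacement \<phi> t \<le> \<epsilon>"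
      using displacement_controlled_by_characters[OF map eps] by blast
    have "displacement \<phi> t \<le> \<epsilon>"
    proof (rule L(2)[rule_format])
      fix \<nu> assume "\<nu> \<in> \<Lambda>"
      then have "\<nu> = 0" using L(1) triv by blast
      then show "Re (ei (\<nu> * t)) \<ge> 1/2" by simp
    qed
    then show ?thesis using dist_le_displacement[OF map, of x t] by linarith
  qed
  then have "dist x (\<phi> t x) \<le> 0" by (rule dense_ge)
  then have "x = \<phi> t x" by (rule dist_le_zero_iff[THEN iffD1])
  then show "\<phi> t x = x" by (rule sym)
qed

lemma singleton_imp_characters_trivial:
  fixes \<phi> :: "real \<Rightarrow> 'a::complete_space \<Rightarrow> 'a"
  assumes map: "minimal_almost_periodic_flow \<phi>" and single: "\<And>x y :: 'a. x = y"
  shows "characters \<phi> = {0}"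
proof -
  have "displacement \<phi> t \<le> 0" for t
  proof (rule displacement_le[OF map])
    show "dist x (\<phi> t x) \<le> 0" for x
      using single[of "\<phi> t x" x] by simp
  qed
  then have small: "displacement \<phi> t < \<delta>" if "\<delta> > 0" for t \<delta>
    using that le_less_trans by blast
  have "\<alpha> = 0" if "\<alpha> \<in> characters \<phi>" for \<alpha>
  proof (rule ccontr)
    assume "\<alpha> \<noteq> 0"
    have "\<forall>\<epsilon>>0. \<exists>\<delta>>0. \<forall>\<tau>. displacement \<phi> \<tau> < \<delta> \<longrightarrow> norm (ei (\<alpha> * \<tau>) - 1) < \<epsilon>"
      using that by (simp only: characters_def mem_Collect_eq)
    from this[rule_format, of 1] obtain \<delta> where "\<delta> > 0"
      "\<And>\<tau>. displacement \<phi> \<tau> < \<delta> \<Longrightarrow> norm (ei (\<alpha> * \<tau>) - 1) < 1"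
      by auto
    \<comment> \<open>At this time the phase is 1/2, where \<open>ei\<close> has the value
      -1.\<close>
    then have "norm (ei (\<alpha> * (1 / (2 * \<alpha>))) - 1) < 1"
      using small by blast
    then show False using norm_ei_ge_1[of "1/2"] \<open>\<alpha> \<noteq> 0\<close> by simp
  qed
  then show ?thesis using zero_in_characters[OF map] by blast
qed

text \<open>The map must send \<open>\<phi> t x0\<close> to \<open>\<psi> (a * t) y0\<close>.
  Finitely many characters of \<psi> control its displacement, and their multiples by
  \<open>a\<close> are characters of \<phi>; so this is well defined and uniformly continuous on a
  dense orbit, and completeness extends it.\<close>

lemma semiconjugacy_of_characters:
  fixes \<phi> :: "real \<Rightarrow> 'a::complete_space \<Rightarrow> 'a" and \<psi> :: "real \<Rightarrow> 'b::complete_space \<Rightarrow> 'b"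
    and a :: real
  assumes map: "minimal_almost_periodic_flow \<phi>" "minimal_almost_periodic_flow \<psi>"
    and sub: "\<And>\<nu>. \<nu> \<in> characters \<psi> \<Longrightarrow> a * \<nu> \<in> characters \<phi>"
  obtains H where "continuous_on UNIV H" "H x0 = y0" "\<And>t x. H (\<phi> t x) = \<psi> (a * t) (H x)"
proof -
  have disp: "\<exists>\<delta>>0. \<forall>\<tau>. displacement \<phi> \<tau> < \<delta> \<longrightarrow> displacement \<psi> (a * \<tau>) \<le> \<epsilon>" if eps: "\<epsilon> > 0" for \<epsilon>
  proof -
    obtain \<Lambda> where L: "finite \<Lambda>" "\<Lambda> \<subseteq> characters \<psi>"
      "\<forall>t. (\<forall>\<nu>\<in>\<Lambda>. Re (ei (\<nu> * t)) \<ge> 1/2) \<longrightarrow> displacement \<psi> t \<le> \<epsilon>"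
      using displacement_controlled_by_characters[OF map(2) eps] by blast
    have "\<exists>\<delta>>0. \<forall>\<tau>. displacement \<phi> \<tau> < \<delta> \<longrightarrow> norm (ei (a * \<nu> * \<tau>) - 1) < 1/2" if "\<nu> \<in> \<Lambda>" for \<nu>
    proof -
      have "a * \<nu> \<in> characters \<phi>" using sub L(2) that by blast
      moreover have "(1/2 :: real) > 0" by simp
      ultimately show ?thesis unfolding characters_def by blast
    qed
    then obtain \<delta> where d: "\<And>\<nu>. \<nu> \<in> \<Lambda> \<Longrightarrow> \<delta> \<nu> > 0"
      "\<And>\<nu> \<tau>. \<nu> \<in> \<Lambda> \<Longrightarrow> displacement \<phi> \<tau> < \<delta> \<nu> \<Longrightarrow> norm (ei (a * \<nu> * \<tau>) - 1) < 1/2"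
      by metis
    \<comment> \<open>The entry 1 covers the case of an empty \<Lambda>.\<close>
    define \<delta>0 where "\<delta>0 = Min (insert 1 (\<delta> ` \<Lambda>))"
    have "\<delta>0 > 0" unfolding \<delta>0_def using L(1) d(1) by (subst Min_gr_iff) auto
    moreover have "displacement \<psi> (a * \<tau>) \<le> \<epsilon>" if less: "displacement \<phi> \<tau> < \<delta>0" for \<tau>
    proof (rule L(3)[rule_format])
      fix \<nu> assume "\<nu> \<in> \<Lambda>"
      then have "\<delta>0 \<le> \<delta> \<nu>" unfolding \<delta>0_def using L(1) by (intro Min_le) auto
      then have "norm (ei (a * \<nu> * \<tau>) - 1) < 1/2" using less \<open>\<nu> \<in> \<Lambda>\<close> by (intro d(2)) auto
      then show "Re (ei (\<nu> * (a * \<tau>))) \<ge> 1/2"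
        using Re_ei_ge[of "a * \<nu> * \<tau>"] by (simp add: mult_ac)
    qed
    ultimately show ?thesis by blast
  qed
  have unif: "\<exists>\<delta>>0. \<forall>s t. dist (\<phi> s x0) (\<phi> t x0) < \<delta> \<longrightarrow> dist (\<psi> (a * s) y0) (\<psi> (a * t) y0) \<le> \<epsilon>"
    if eps: "\<epsilon> > 0" for \<epsilon>
  proof -
    obtain \<delta>1 where d1: "\<delta>1 > 0" "\<And>\<tau>. displacement \<phi> \<tau> < \<delta>1 \<Longrightarrow> displacement \<psi> (a * \<tau>) \<le> \<epsilon>"
      using disp[OF eps] by blast
    obtain \<delta> where d: "\<delta> > 0" "\<And>s t x. dist (\<phi> s x) (\<phi> t x) < \<delta> \<Longrightarrow> displacement \<phi> (t - s) < \<delta>1"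
      using displacement_small[OF map(1) d1(1)] by blast
    have "dist (\<psi> (a * s) y0) (\<psi> (a * t) y0) \<le> \<epsilon>" if "dist (\<phi> s x0) (\<phi> t x0) < \<delta>" for s t
      using dist_le_displacement_diff[OF map(2), of "a * s" y0 "a * t"] d1(2)[OF d(2)[OF that]]
      by (simp add: right_diff_distrib)
    then show ?thesis using d(1) by blast
  qed
  \<comment> \<open>The time need not be unique, as the orbit may be periodic; \<open>unif\<close>
    shows that the choice does not matter.\<close>
  define G where "G x = \<psi> (a * (SOME t. \<phi> t x0 = x)) y0" for x
  have G: "G (\<phi> t x0) = \<psi> (a * t) y0" for t
  proof -
    define s where "s = (SOME s. \<phi> s x0 = \<phi> t x0)"
    have s: "\<phi> s x0 = \<phi> t x0" unfolding s_def by (rule someI) (rule refl)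
    have "dist (\<psi> (a * s) y0) (\<psi> (a * t) y0) \<le> \<epsilon>" if "\<epsilon> > 0" for \<epsilon>
      using unif[OF that] s by auto
    then have "dist (\<psi> (a * s) y0) (\<psi> (a * t) y0) \<le> 0"
      by (rule dense_ge)
    then show ?thesis by (simp add: G_def s_def)
  qed
  let ?O = "range (\<lambda>t. \<phi> t x0)"
  have "uniformly_continuous_on ?O G"
    unfolding uniformly_continuous_on_def
  proof (intro allI impI)
    fix \<epsilon> :: real assume "\<epsilon> > 0"
    then obtain \<delta> where d: "\<delta> > 0" "\<And>s t. dist (\<phi> s x0) (\<phi> t x0) < \<delta> \<Longrightarrow> dist (\<psi> (a * s) y0) (\<psi> (a * t) y0) \<le> \<epsilon> / 2"
      using unif[of "\<epsilon> / 2"] by auto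
    have "dist (G (\<phi> s x0)) (G (\<phi> t x0)) < \<epsilon>" if "dist (\<phi> s x0) (\<phi> t x0) < \<delta>" for s t
      using d(2)[OF that] \<open>\<epsilon> > 0\<close> by (simp add: G)
    then show "\<exists>d>0. \<forall>x\<in>?O. \<forall>x'\<in>?O. dist x' x < d \<longrightarrow> dist (G x') (G x) < \<epsilon>"
      using d(1) by (intro exI[of _ \<delta>]) auto
  qed
  then obtain H where "uniformly_continuous_on (closure ?O) H" and HG: "\<And>x. x \<in> ?O \<Longrightarrow> G x = H x"
    by (rule uniformly_continuous_on_extension_on_closure) blast
  then have "uniformly_continuous_on UNIV H" by (simp only: orbit_dense[OF map(1)])
  then have Hc: "continuous_on UNIV H" by (rule uniformly_continuous_imp_continuous)
  have HO: "H (\<phi> t x0) = \<psi> (a * t) y0" for t using HG[of "\<phi> t x0"] G by auto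
  show ?thesis
  proof (rule that[OF Hc])
    show "H x0 = y0" using HO[of 0] by (simp add: flow_0[OF map(1)] flow_0[OF map(2)])
    fix t x
    have "x \<in> {x. H (\<phi> t x) = \<psi> (a * t) (H x)}"
    proof (rule closed_contains_orbit[OF map(1), of _ x0])
      show "closed {x. H (\<phi> t x) = \<psi> (a * t) (H x)}"
        by (intro closed_Collect_eq continuous_on_compose2[OF Hc] flow_continuous_compose[OF map(1)]
            flow_continuous_compose[OF map(2)] continuous_intros Hc) auto
      show "\<phi> s x0 \<in> {x. H (\<phi> t x) = \<psi> (a * t) (H x)}" for s
        by (simp add: HO distrib_left flip: flow_add[OF map(1)] flow_add[OF map(2)])
    qed
    then show "H (\<phi> t x) = \<psi> (a * t) (H x)" by simp
  qed
qed


section \<open>From topological equivalence to exponents\<close>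

lemma bounded_mono_tendsto_at_top:
  fixes \<sigma> :: "real \<Rightarrow> real"
  assumes mono: "mono \<sigma>" and bdd: "\<And>t. \<sigma> t \<le> C"
  obtains S where "(\<sigma> \<longlongrightarrow> S) at_top"
proof -
  define S where "S = (SUP t. \<sigma> t)"
  have bdd': "bdd_above (range \<sigma>)" using bdd by (intro bdd_aboveI2)
  have "(\<sigma> \<longlongrightarrow> S) at_top"
  proof (rule order_tendstoI)
    fix y assume "y < S"
    then obtain t0 where "y < \<sigma> t0"
      using less_cSUP_iff[OF _ bdd'] by (auto simp: S_def)
    then have "y < \<sigma> t" if "t \<ge> t0" for t
      using monoD[OF mono that] by linarith
    then show "\<forall>\<^sub>F t in at_top. y < \<sigma> t" by (rule eventually_at_top_linorderI)
  next
    fix y assume "S < y"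
    moreover have "\<sigma> t \<le> S" for t unfolding S_def by (rule cSUP_upper[OF UNIV_I bdd'])
    ultimately show "\<forall>\<^sub>F t in at_top. \<sigma> t < y"
      by (intro always_eventually allI) (rule le_less_trans)
  qed
  then show ?thesis by (rule that)
qed

lemma topologically_equivalent_imp_characters:
  fixes \<phi> :: "real \<Rightarrow> 'a::complete_space \<Rightarrow> 'a" and \<psi> :: "real \<Rightarrow> 'b::complete_space \<Rightarrow> 'b"
  assumes map: "minimal_almost_periodic_flow \<phi>" "minimal_almost_periodic_flow \<psi>"
    and equiv: "topologically_equivalent \<phi> \<psi>"
  shows "\<exists>a. a \<noteq> 0 \<and> characters \<phi> = (\<lambda>\<nu>. a * \<nu>) ` characters \<psi>"
proof -
  obtain h k where hk: "homeomorphism UNIV UNIV h k"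
    and rep: "\<forall>x. \<exists>\<sigma> :: real \<Rightarrow> real. continuous_on UNIV \<sigma> \<and> strict_mono \<sigma> \<and>
               (\<forall>t. h (orbit_map \<phi> x t) = orbit_map \<psi> (h x) (\<sigma> t))"
    using equiv unfolding topologically_equivalent_def by blast
  have hc: "continuous_on UNIV h" and kc: "continuous_on UNIV k"
    and kh [simp]: "k (h x) = x" and hk' [simp]: "h (k y) = y" for x y
    using hk by (auto simp: homeomorphism_def)
  fix x0 :: 'a
  define y0 where "y0 = h x0"
  have ky0: "k y0 = x0" by (simp add: y0_def)
  from rep obtain \<sigma> where \<sigma>: "continuous_on UNIV \<sigma>" "strict_mono \<sigma>"
    and "\<forall>t. h (orbit_map \<phi> x0 t) = orbit_map \<psi> (h x0) (\<sigma> t)" by blast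
  then have h\<sigma>: "h (\<phi> t x0) = \<psi> (\<sigma> t) (h x0)" for t by (simp add: orbit_map_def)
  show ?thesis
  \<comment> \<open>In the trivial case both spaces are single points and the factor 1
    serves.\<close>
  proof (cases "characters \<psi> \<subseteq> {0}")
    case True
    then have "y = y'" for y y' :: 'b
      by (rule characters_trivial_imp_singleton[OF map(2)])
    then have "h x = h x'" for x x' by blast
    then have "x = x'" for x x' :: 'a using kh by metis
    then have "characters \<phi> = {0}" by (rule singleton_imp_characters_trivial[OF map(1)])
    moreover have "characters \<psi> = {0}" using True zero_in_characters[OF map(2)] by blast
    ultimately show ?thesis by (intro exI[of _ 1]) simp
  next
    case False
    then obtain \<nu>0 where \<nu>0: "\<nu>0 \<in> characters \<psi>" "\<nu>0 \<noteq> 0" by blast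
    obtain \<mu>0 C0 where "\<mu>0 \<in> characters \<phi>" and mu0: "\<And>t. \<bar>\<nu>0 * \<sigma> t - \<mu>0 * t\<bar> \<le> C0"
      using characters_pullback[OF map hc \<sigma>(1) h\<sigma> \<nu>0(1)] by blast
    define a where "a = \<mu>0 / \<nu>0"
    define C where "C = C0 / \<bar>\<nu>0\<bar>"
    have lin: "\<bar>\<sigma> t - a * t\<bar> \<le> C" for t
    proof -
      have "\<sigma> t - a * t = (\<nu>0 * \<sigma> t - \<mu>0 * t) / \<nu>0"
        using \<nu>0(2) by (simp add: a_def field_simps)
      then have "\<bar>\<sigma> t - a * t\<bar> = \<bar>\<nu>0 * \<sigma> t - \<mu>0 * t\<bar> / \<bar>\<nu>0\<bar>"
        by (simp only: abs_divide)
      also have "\<dots> \<le> C" unfolding C_def using mu0 by (rule divide_right_mono) simp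
      finally show ?thesis .
    qed
    have unique_slope: "\<mu> = a * \<nu>" if "\<And>t. \<bar>\<nu> * \<sigma> t - \<mu> * t\<bar> \<le> K" for \<mu> \<nu> K
    proof -
      have "\<bar>(\<mu> - a * \<nu>) * t\<bar> \<le> K + \<bar>\<nu>\<bar> * C" for t
      proof -
        have "\<bar>\<nu> * (\<sigma> t - a * t)\<bar> \<le> \<bar>\<nu>\<bar> * C"
          unfolding abs_mult using lin by (rule mult_left_mono) simp
        moreover have "(\<mu> - a * \<nu>) * t = \<nu> * (\<sigma> t - a * t) - (\<nu> * \<sigma> t - \<mu> * t)"
          by (simp add: algebra_simps)
        ultimately show ?thesis using that[of t] by linarith
      qed
      then show ?thesis using bounded_multiples_imp_zero by fastforce
    qed
    \<comment> \<open>With slope 0 the increasing time change would be bounded, hence convergent,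
      and the orbit of \<open>x0\<close> would tend to a point fixed by the flow. Both spaces would
      then be single points, contrary to the nonzero exponent.\<close>
    have "a \<noteq> 0"
    proof
      assume "a = 0"
      then have "\<sigma> t \<le> C" for t using lin[of t] by simp
      then obtain S where S: "(\<sigma> \<longlongrightarrow> S) at_top"
        using bounded_mono_tendsto_at_top strict_mono_mono[OF \<sigma>(2)] by blast
      define p where "p = k (\<psi> S y0)"
      have "continuous_on UNIV (\<lambda>s. k (\<psi> s y0))"
        by (intro continuous_on_compose2[OF kc] flow_continuous_compose[OF map(2)] continuous_intros) auto
      from continuous_on_tendsto_compose[OF this S]
      have "((\<lambda>t. k (\<psi> (\<sigma> t) y0)) \<longlongrightarrow> p) at_top" by (simp add: p_def)
      moreover have "k (\<psi> (\<sigma> t) y0) = \<phi> t x0" for t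
        by (simp add: y0_def flip: h\<sigma>)
      ultimately have lim: "((\<lambda>t. \<phi> t x0) \<longlongrightarrow> p) at_top" by simp
      have "\<phi> r p = p" for r
      proof -
        have "filterlim (\<lambda>t. r + t) at_top at_top"
          by (intro filterlim_tendsto_add_at_top[OF tendsto_const] filterlim_ident)
        from filterlim_compose[OF lim this]
        have "((\<lambda>t. \<phi> r (\<phi> t x0)) \<longlongrightarrow> p) at_top" by (simp only: flow_add[OF map(1)])
        moreover have "continuous_on UNIV (\<phi> r)"
          using flow_continuous_compose[OF map(1) continuous_on_const continuous_on_id] by simp
        from continuous_on_tendsto_compose[OF this lim]
        have "((\<lambda>t. \<phi> r (\<phi> t x0)) \<longlongrightarrow> \<phi> r p) at_top" by simp
        ultimately show ?thesis using tendsto_unique trivial_limit_at_top_linorder by metis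
      qed
      then have "x = x'" for x x' :: 'a by (rule fixed_point_imp_singleton[OF map(1)])
      then have "k y = k y'" for y y' by blast
      then have "y = y'" for y y' :: 'b using hk' by metis
      then have "characters \<psi> = {0}" by (rule singleton_imp_characters_trivial[OF map(2)])
      then show False using False by simp
    qed
    have "surj \<sigma>"
    proof -
      have "connected (range \<sigma>)" using \<sigma>(1) connected_UNIV by (rule connected_continuous_image)
      have "s \<in> range \<sigma>" for s
      \<comment> \<open>At these two times \<open>a * t\<close> equals \<open>s - C\<close> and
        \<open>s + C\<close>, whatever the sign of \<open>a\<close>, so the values of \<sigma>
        enclose \<open>s\<close>.\<close>
      proof (rule connectedD_interval[OF \<open>connected (range \<sigma>)\<close>])
        show "\<sigma> ((s - C) / a) \<in> range \<sigma>" "\<sigma> ((s + C) / a) \<in> range \<sigma>" by auto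
        show "\<sigma> ((s - C) / a) \<le> s" "s \<le> \<sigma> ((s + C) / a)"
          using lin[of "(s - C) / a"] lin[of "(s + C) / a"] \<open>a \<noteq> 0\<close> by auto
      qed
      then show ?thesis by blast
    qed
    define \<rho> where "\<rho> = inv \<sigma>"
    have \<sigma>\<rho>: "\<sigma> (\<rho> s) = s" for s using \<open>surj \<sigma>\<close> by (simp add: \<rho>_def surj_f_inv_f)
    have \<rho>\<sigma>: "\<rho> (\<sigma> t) = t" for t
      using strict_mono_eq[OF \<sigma>(2)] \<sigma>\<rho> by blast
    have \<rho>c: "continuous_on UNIV \<rho>"
    proof (rule continuous_onI_mono)
      have "range \<rho> = UNIV" using \<rho>\<sigma> by (metis surjI)
      then show "open (range \<rho>)" by simp
      show "\<rho> s \<le> \<rho> t" if "s \<le> t" for s t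
        using that strict_mono_less_eq[OF \<sigma>(2), of "\<rho> s" "\<rho> t"] by (simp add: \<sigma>\<rho>)
    qed
    have k\<rho>: "k (\<psi> s y0) = \<phi> (\<rho> s) (k y0)" for s
      using h\<sigma>[of "\<rho> s"] by (simp add: \<sigma>\<rho> ky0 flip: y0_def) (metis kh)
    have "characters \<phi> = (\<lambda>\<nu>. a * \<nu>) ` characters \<psi>"
    proof (intro set_eqI iffI)
      fix \<mu> assume "\<mu> \<in> characters \<phi>"
      then obtain \<nu> K where "\<nu> \<in> characters \<psi>" and nu: "\<And>s. \<bar>\<mu> * \<rho> s - \<nu> * s\<bar> \<le> K"
        using characters_pullback[OF map(2,1) kc \<rho>c k\<rho>] by blast
      \<comment> \<open>Evaluating the estimate for the inverse time change at
        \<open>\<sigma> t\<close> turns it into one for \<sigma>.\<close>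
      have "\<bar>\<nu> * \<sigma> t - \<mu> * t\<bar> \<le> K" for t
        using nu[of "\<sigma> t"] by (simp add: \<rho>\<sigma> abs_minus_commute)
      then have "\<mu> = a * \<nu>" by (rule unique_slope)
      then show "\<mu> \<in> (\<lambda>\<nu>. a * \<nu>) ` characters \<psi>" using \<open>\<nu> \<in> characters \<psi>\<close> by blast
    next
      fix \<alpha> assume "\<alpha> \<in> (\<lambda>\<nu>. a * \<nu>) ` characters \<psi>"
      then obtain \<nu> where nu: "\<nu> \<in> characters \<psi>" "\<alpha> = a * \<nu>" by blast
      obtain \<mu> K where "\<mu> \<in> characters \<phi>" "\<And>t. \<bar>\<nu> * \<sigma> t - \<mu> * t\<bar> \<le> K"
        using characters_pullback[OF map hc \<sigma>(1) h\<sigma> nu(1)] by blast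
      then show "\<alpha> \<in> characters \<phi>" using unique_slope nu(2) by blast
    qed
    then show ?thesis using \<open>a \<noteq> 0\<close> by blast
  qed
qed

section \<open>From exponents to topological equivalence\<close>

lemma characters_imp_topologically_equivalent:
  fixes \<phi> :: "real \<Rightarrow> 'a::complete_space \<Rightarrow> 'a" and \<psi> :: "real \<Rightarrow> 'b::complete_space \<Rightarrow> 'b"
  assumes map: "minimal_almost_periodic_flow \<phi>" "minimal_almost_periodic_flow \<psi>"
    and "a \<noteq> 0" and eq: "characters \<phi> = (\<lambda>\<nu>. a * \<nu>) ` characters \<psi>"
  shows "topologically_equivalent \<phi> \<psi>"
proof -
  \<comment> \<open>A positive factor is needed for an increasing change of time.\<close>
  define b where "b = \<bar>a\<bar>"
  have "b > 0" using \<open>a \<noteq> 0\<close> by (simp add: b_def)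
  have forth: "b * \<nu> \<in> characters \<phi>" if "\<nu> \<in> characters \<psi>" for \<nu>
  proof -
    have "a * \<nu> \<in> characters \<phi>" using eq that by blast
    then show ?thesis
      using characters_uminus[OF map(1), of "a * \<nu>"] by (cases "a \<ge> 0") (auto simp: b_def)
  qed
  have inverse: "1 / b * \<mu> \<in> characters \<psi>" if mu: "\<mu> \<in> characters \<phi>" for \<mu>
  proof -
    obtain \<nu> where nu: "\<nu> \<in> characters \<psi>" "\<mu> = a * \<nu>" using eq mu by blast
    then have "1 / b * \<mu> = \<nu> \<or> 1 / b * \<mu> = - \<nu>"
      using \<open>a \<noteq> 0\<close> by (cases "a \<ge> 0") (auto simp: b_def)
    then show ?thesis using nu(1) characters_uminus[OF map(2), of \<nu>] by metis
  qed
  fix x0 :: 'a and y0 :: 'b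
  obtain H where H: "continuous_on UNIV H" "H x0 = y0" "\<And>t x. H (\<phi> t x) = \<psi> (b * t) (H x)"
    using semiconjugacy_of_characters[OF map forth, of x0 y0] by blast
  obtain K where K: "continuous_on UNIV K" "K y0 = x0" "\<And>t y. K (\<psi> t y) = \<phi> (1 / b * t) (K y)"
    using semiconjugacy_of_characters[OF map(2,1) inverse, of y0 x0] by blast
  \<comment> \<open>The two semiconjugacies use inverse factors and matching base points, so each
    composition fixes a dense orbit pointwise and hence everything.\<close>
  have KH: "K (H x) = x" for x
  proof -
    have "x \<in> {x. K (H x) = x}"
    proof (rule closed_contains_orbit[OF map(1), of _ x0])
      show "closed {x. K (H x) = x}"
        by (intro closed_Collect_eq continuous_on_compose2[OF K(1)] H(1) continuous_on_id) auto
      show "\<phi> t x0 \<in> {x. K (H x) = x}" for t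
        using \<open>b > 0\<close> by (simp add: H(2,3) K(2,3))
    qed
    then show ?thesis by simp
  qed
  have HK: "H (K y) = y" for y
  proof -
    have "y \<in> {y. H (K y) = y}"
    proof (rule closed_contains_orbit[OF map(2), of _ y0])
      show "closed {y. H (K y) = y}"
        by (intro closed_Collect_eq continuous_on_compose2[OF H(1)] K(1) continuous_on_id) auto
      show "\<psi> t y0 \<in> {y. H (K y) = y}" for t
        using \<open>b > 0\<close> by (simp add: H(2,3) K(2,3))
    qed
    then show ?thesis by simp
  qed
  have "homeomorphism UNIV UNIV H K"
    by (rule homeomorphismI) (use H(1) K(1) KH HK in auto)
  moreover have "H ` range (orbit_map \<phi> x) = range (orbit_map \<psi> (H x))" for x
  proof -
    have "range (\<lambda>t. b * t) = UNIV"
      using \<open>b > 0\<close> by (intro surjI[of _ "\<lambda>t. t / b"]) simp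
    then have "range (\<lambda>t. \<psi> (b * t) (H x)) = range (\<lambda>t. \<psi> t (H x))"
      using image_image[of "\<lambda>t. \<psi> t (H x)" "\<lambda>t. b * t" UNIV] by simp
    then show ?thesis by (simp add: orbit_map_def[abs_def] image_image H(3))
  qed
  moreover have "continuous_on UNIV (\<lambda>t. b * t)" by (intro continuous_intros)
  moreover have "strict_mono (\<lambda>t. b * t)" using \<open>b > 0\<close> by (simp add: strict_mono_def)
  moreover have "H (orbit_map \<phi> x t) = orbit_map \<psi> (H x) (b * t)" for x t
    by (simp add: orbit_map_def H(3))
  ultimately show ?thesis unfolding topologically_equivalent_def by blast
qed

theorem theorem9:
  fixes \<phi> :: "real \<Rightarrow> 'a::complete_space \<Rightarrow> 'a"
    and \<psi> :: "real \<Rightarrow> 'b::complete_space \<Rightarrow> 'b"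
  assumes "minimal_almost_periodic_flow \<phi>"
    and "minimal_almost_periodic_flow \<psi>"
  shows "topologically_equivalent \<phi> \<psi> \<longleftrightarrow>
    (\<exists>a::real. a \<noteq> 0 \<and> flow_exponent_group \<phi> = (\<lambda>\<nu>. a * \<nu>) ` flow_exponent_group \<psi>)"
  unfolding flow_exponent_group_eq[OF assms(1)] flow_exponent_group_eq[OF assms(2)]
  using topologically_equivalent_imp_characters[OF assms]
    characters_imp_topologically_equivalent[OF assms] by blast

end
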